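(* Let $J$ and $I$ be $m$-regular Borel-fixed ideals in $S$ such that $\mathrm{Proj}(S/J)$ and $\mathrm{Proj}(S/I)$ share the same Hilbert polynomial $p(t)$. If $p(t)=d$ is a constant Hilbert polynomial, then $J_m\prec\!\!\prec I_m$ if and only if $J_{m+1}\prec\!\!\prec I_{m+1}$, for every term order $\prec$ on $S$.
   Context: $K$ is an infinite field, $S=K[x_0,\dots,x_n]$ with the standard grading; a term is a monic monomial; term orders satisfy $x_0\prec\dots\prec x_n$. $\mathrm{GL}_K(n+1)$ acts on $S$ by $g(f)=f(\sum_j g_{0j}x_j,\dots,\sum_j g_{nj}x_j)$; an ideal is Borel-fixed if it is fixed by all upper-triangular invertible matrices (hence it is monomial). A homogeneous ideal $I$ is $m$-regular if its Castelnuovo–Mumford regularity is at most $m$. $I_m$ denotes the degree $m$ component. For subspaces $V,V'$ of $S_t$ of the same finite dimension spanned by sets of terms $A,B$ respectively, $V\prec\!\!\prec V'$ means that there is a bijection $\omega:A\to B$ with $a\preceq\omega(a)$ for every $a\in A$. *)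

theory Defs
  imports
    "HOL-Library.Poly_Mapping"
    "HOL-Library.Extended_Real"
    "HOL-Computational_Algebra.Polynomial"
    "Jordan_Normal_Form.Matrix"
begin

section \<open>The polynomial ring\<close>

text \<open>
  Terms are identified with their exponent vectors. The ambient types have countably many
  variables; \<open>K[x\<^sub>0,\<dots>,x\<^sub>n]\<close> is the subset \<open>poly_ring n\<close> of polynomials involving
  only variables with index at most \<open>n\<close>.
\<close>

type_synonym term_exp = "nat \<Rightarrow>\<^sub>0 nat"
type_synonym 'k mpoly = "term_exp \<Rightarrow>\<^sub>0 'k"

definition terms :: "nat \<Rightarrow> term_exp set" where
  "terms n = {t. Poly_Mapping.keys t \<subseteq> {..n}}"

definition term_deg :: "term_exp \<Rightarrow> nat" where
  "term_deg t = (\<Sum>i\<in>Poly_Mapping.keys t. Poly_Mapping.lookup t i)"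

definition var_exp :: "nat \<Rightarrow> term_exp" where
  "var_exp i = Poly_Mapping.single i 1"

definition term_poly :: "term_exp \<Rightarrow> 'k::field mpoly" where
  "term_poly t = Poly_Mapping.single t 1"

definition const_poly :: "'k::field \<Rightarrow> 'k mpoly" where
  "const_poly c = Poly_Mapping.single 0 c"

definition poly_ring :: "nat \<Rightarrow> 'k::field mpoly set" where
  "poly_ring n = {f. Poly_Mapping.keys f \<subseteq> terms n}"

definition poly_scale :: "'k::field \<Rightarrow> 'k mpoly \<Rightarrow> 'k mpoly" where
  "poly_scale c f = const_poly c * f"

interpretation mpoly: vector_space poly_scale
  by unfold_locales
    (simp_all add: poly_scale_def const_poly_def algebra_simps mult_single single_add
       flip: mult.assoc single_one)

definition graded_piece :: "nat \<Rightarrow> nat \<Rightarrow> 'k::field mpoly set" where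
  "graded_piece n t = {f \<in> poly_ring n. \<forall>s\<in>Poly_Mapping.keys f. term_deg s = t}"

definition hom_component :: "nat \<Rightarrow> 'k::field mpoly \<Rightarrow> 'k mpoly" where
  "hom_component t f =
     (\<Sum>s\<in>{s \<in> Poly_Mapping.keys f. term_deg s = t}.
        Poly_Mapping.single s (Poly_Mapping.lookup f s))"


section \<open>Ideals\<close>

definition is_ideal :: "nat \<Rightarrow> 'k::field mpoly set \<Rightarrow> bool" where
  "is_ideal n I \<longleftrightarrow>
     I \<subseteq> poly_ring n \<and> 0 \<in> I \<and> (\<forall>f\<in>I. \<forall>g\<in>I. f + g \<in> I) \<and>
     (\<forall>f\<in>I. \<forall>h\<in>poly_ring n. h * f \<in> I)"

definition homogeneous_ideal :: "nat \<Rightarrow> 'k::field mpoly set \<Rightarrow> bool" where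
  "homogeneous_ideal n I \<longleftrightarrow> is_ideal n I \<and> (\<forall>f\<in>I. \<forall>t. hom_component t f \<in> I)"

definition ideal_piece :: "nat \<Rightarrow> 'k::field mpoly set \<Rightarrow> nat \<Rightarrow> 'k mpoly set" where
  "ideal_piece n I t = I \<inter> graded_piece n t"

definition poly_subst :: "(nat \<Rightarrow> 'k mpoly) \<Rightarrow> 'k::field mpoly \<Rightarrow> 'k mpoly" where
  "poly_subst \<sigma> f =
     (\<Sum>s\<in>Poly_Mapping.keys f. const_poly (Poly_Mapping.lookup f s) *
        (\<Prod>i\<in>Poly_Mapping.keys s. \<sigma> i ^ Poly_Mapping.lookup s i))"

definition gl_act :: "nat \<Rightarrow> 'k::field mat \<Rightarrow> 'k mpoly \<Rightarrow> 'k mpoly" where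
  "gl_act n g = poly_subst (\<lambda>i. \<Sum>j\<le>n. const_poly (g $$ (i, j)) * term_poly (var_exp j))"

definition borel_fixed_ideal :: "nat \<Rightarrow> 'k::field mpoly set \<Rightarrow> bool" where
  "borel_fixed_ideal n I \<longleftrightarrow> is_ideal n I \<and>
     (\<forall>g \<in> carrier_mat (n + 1) (n + 1).
        invertible_mat g \<longrightarrow> upper_triangular g \<longrightarrow> gl_act n g ` I = I)"


section \<open>Hilbert polynomials\<close>

text \<open>
  \<open>dim\<^sub>K (S/I)\<^sub>t\<close>, written as a difference of dimensions because the libraries have no
  quotient spaces; the truncated subtraction is exact since \<open>I\<^sub>t \<subseteq> S\<^sub>t\<close> and
  \<open>S\<^sub>t\<close> is finite-dimensional.
\<close>

definition hilbert_function :: "nat \<Rightarrow> 'k::field mpoly set \<Rightarrow> nat \<Rightarrow> nat" where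
  "hilbert_function n I t =
     mpoly.dim (graded_piece n t :: 'k mpoly set) - mpoly.dim (ideal_piece n I t)"

definition is_hilbert_polynomial :: "nat \<Rightarrow> 'k::field mpoly set \<Rightarrow> rat poly \<Rightarrow> bool" where
  "is_hilbert_polynomial n I p \<longleftrightarrow>
     (\<forall>\<^sub>F t in sequentially. poly p (of_nat t) = of_nat (hilbert_function n I t))"


section \<open>Castelnuovo--Mumford regularity\<close>

text \<open>
  A complex \<open>\<dots> \<rightarrow> F\<^sub>1 \<rightarrow> F\<^sub>0 \<rightarrow> S\<close> of finitely generated graded free modules,
  \<open>F\<^sub>i = \<Oplus>\<^sub>j S(-shift i j)\<close> with \<open>j < rank i\<close>. The matrix \<open>augm\<close> represents
  \<open>F\<^sub>0 \<rightarrow> S\<close>, and \<open>diff i\<close> represents \<open>F\<^sub>i\<^sub>+\<^sub>1 \<rightarrow> F\<^sub>i\<close>. A finite resolution has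
  \<open>rank i = 0\<close> from some \<open>i\<close> on.
\<close>

record (overloaded) 'k free_complex =
  rank :: "nat \<Rightarrow> nat"
  shift :: "nat \<Rightarrow> nat \<Rightarrow> int"
  augm :: "'k mpoly mat"
  diff :: "nat \<Rightarrow> 'k mpoly mat"

definition free_module :: "nat \<Rightarrow> nat \<Rightarrow> 'k::field mpoly vec set" where
  "free_module n r = {v \<in> carrier_vec r. \<forall>j<r. v $ j \<in> poly_ring n}"

text \<open>
  The matrix of a degree-preserving map \<open>\<Oplus>\<^sub>j S(-b j) \<rightarrow> \<Oplus>\<^sub>k S(-a k)\<close>: the entry
  \<open>(k, j)\<close> is zero or homogeneous of degree \<open>b j - a k\<close>.
\<close>

definition graded_matrix ::
    "nat \<Rightarrow> nat \<Rightarrow> (nat \<Rightarrow> int) \<Rightarrow> nat \<Rightarrow> (nat \<Rightarrow> int) \<Rightarrow> 'k::field mpoly mat \<Rightarrow> bool" where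
  "graded_matrix n r a s b M \<longleftrightarrow> M \<in> carrier_mat r s \<and>
     (\<forall>k<r. \<forall>j<s. M $$ (k, j) \<in> poly_ring n \<and>
        (\<forall>u\<in>Poly_Mapping.keys (M $$ (k, j)). int (term_deg u) = b j - a k))"

definition graded_free_resolution ::
    "nat \<Rightarrow> 'k::field mpoly set \<Rightarrow> 'k free_complex \<Rightarrow> bool" where
  "graded_free_resolution n I F \<longleftrightarrow>
     graded_matrix n 1 (\<lambda>_. 0) (rank F 0) (shift F 0) (augm F) \<and>
     (\<forall>i. graded_matrix n (rank F i) (shift F i) (rank F (Suc i)) (shift F (Suc i)) (diff F i)) \<and>
     (\<lambda>v. (augm F *\<^sub>v v) $ 0) ` free_module n (rank F 0) = I \<and>
     {v \<in> free_module n (rank F 0). augm F *\<^sub>v v = 0\<^sub>v 1} =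
       (\<lambda>w. diff F 0 *\<^sub>v w) ` free_module n (rank F 1) \<and>
     (\<forall>i. {v \<in> free_module n (rank F (Suc i)). diff F i *\<^sub>v v = 0\<^sub>v (rank F i)} =
       (\<lambda>w. diff F (Suc i) *\<^sub>v w) ` free_module n (rank F (Suc (Suc i))))"

text \<open>
  Minimality means that the image of \<open>F\<^sub>i\<^sub>+\<^sub>1\<close> lies in \<open>(x\<^sub>0,\<dots>,x\<^sub>n) F\<^sub>i\<close>, that is,
  the entries of \<open>diff i\<close> have no constant coefficient.
\<close>

definition minimal_graded_free_resolution ::
    "nat \<Rightarrow> 'k::field mpoly set \<Rightarrow> 'k free_complex \<Rightarrow> bool" where
  "minimal_graded_free_resolution n I F \<longleftrightarrow> graded_free_resolution n I F \<and>
     (\<forall>i. \<forall>k<rank F i. \<forall>j<rank F (Suc i). Poly_Mapping.lookup (diff F i $$ (k, j)) 0 = 0)"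

text \<open>
  The maximum of \<open>shift i j - i\<close> over the minimal graded free resolution of the ideal. That
  resolution is unique up to isomorphism, so the infimum over \<open>F\<close> ranges over a single value.
  The zero ideal has regularity \<open>-\<infinity>\<close>.
\<close>

definition cm_regularity :: "nat \<Rightarrow> 'k::field mpoly set \<Rightarrow> ereal" where
  "cm_regularity n I =
     (INF F\<in>{F. minimal_graded_free_resolution n I F}.
        SUP (i, j)\<in>{(i, j). j < rank F i}. ereal (of_int (shift F i j - int i)))"

definition m_regular :: "nat \<Rightarrow> nat \<Rightarrow> 'k::field mpoly set \<Rightarrow> bool" where
  "m_regular n m I \<longleftrightarrow> homogeneous_ideal n I \<and> cm_regularity n I \<le> ereal (of_nat m)"


section \<open>Term orders and the comparison of subspaces\<close>

text \<open>
  A term order \<open>\<preceq>\<close> is given as the set of pairs \<open>(s, t)\<close> with \<open>s \<preceq> t\<close>. Multiplication of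
  terms is addition of exponents, and \<open>0\<close> is the term \<open>1\<close>.
\<close>

definition term_order :: "nat \<Rightarrow> (term_exp \<times> term_exp) set \<Rightarrow> bool" where
  "term_order n ord \<longleftrightarrow> linear_order_on (terms n) ord \<and>
     (\<forall>t\<in>terms n. (0, t) \<in> ord) \<and>
     (\<forall>(s, t)\<in>ord. \<forall>u\<in>terms n. (u + s, u + t) \<in> ord) \<and>
     (\<forall>i j. i < j \<longrightarrow> j \<le> n \<longrightarrow> (var_exp i, var_exp j) \<in> ord)"

text \<open>
  The relation \<open>V \<prec>\<prec> V'\<close> for subspaces of \<open>S\<^sub>t\<close> spanned by terms. The sets \<open>A\<close> and
  \<open>B\<close> are determined by \<open>V\<close> and \<open>V'\<close>.
\<close>

definition span_dominated ::
    "nat \<Rightarrow> nat \<Rightarrow> (term_exp \<times> term_exp) set \<Rightarrow> 'k::field mpoly set \<Rightarrow> 'k mpoly set \<Rightarrow> bool" where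
  "span_dominated n t ord V V' \<longleftrightarrow> mpoly.dim V = mpoly.dim V' \<and>
     (\<exists>A B. A \<subseteq> {s \<in> terms n. term_deg s = t} \<and> B \<subseteq> {s \<in> terms n. term_deg s = t} \<and>
        V = mpoly.span (term_poly ` A) \<and> V' = mpoly.span (term_poly ` B) \<and>
        (\<exists>\<omega>. bij_betw \<omega> A B \<and> (\<forall>a\<in>A. (a, \<omega> a) \<in> ord)))"

end

theory Submission
  imports Defs "Jordan_Normal_Form.Determinant"
begin

text \<open>
  Degree by degree, \<open>J\<^sub>t\<close> is dominated by \<open>I\<^sub>t\<close> if and only if the terms of \<open>S\<^sub>t\<close> outside
  \<open>I\<close> are dominated by those outside \<open>J\<close>. It therefore suffices that for an
  \<open>m\<close>-regular Borel-fixed ideal with constant Hilbert polynomial the terms outside the ideal in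
  degree \<open>m + 1\<close> are the \<open>x\<^sub>0\<close>-multiples of those in degree \<open>m\<close>.

  The key is a socle lemma: if \<open>T\<close> is a nonempty set of variables and \<open>f\<close> a term in these
  variables, of degree at least \<open>m\<close>, with \<open>x\<^sub>j f \<in> I\<close> for all \<open>j \<in> T\<close>, then \<open>f \<in> I\<close>. For
  otherwise \<open>f e\<^sub>T\<close> would be a nontrivial Koszul cycle of \<open>S/I\<close> in a degree where the free
  resolution forces the Koszul homology to vanish. Passing to maximal multiples, it is enough
  that a power of each \<open>x\<^sub>j\<close> with \<open>j \<in> T\<close> multiplies \<open>f\<close> into \<open>I\<close>. With \<open>T\<close> the set of all
  variables, Borel-fixedness yields that multiplication by \<open>x\<^sub>0\<close> is injective on \<open>S/I\<close> from
  degree \<open>m\<close> on. With \<open>T = {x\<^sub>1,\<dots>,x\<^sub>n}\<close>, of which \<open>I\<close> contains powers since the Hilbert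
  polynomial is constant, every term of degree \<open>m + 1\<close> outside \<open>I\<close> is divisible by \<open>x\<^sub>0\<close>.
\<close>

section \<open>Terms and polynomials\<close>

abbreviation "keys \<equiv> Poly_Mapping.keys"
abbreviation "lookup \<equiv> Poly_Mapping.lookup"

lemma keys_plus_nat: "keys (s + t :: 'a \<Rightarrow>\<^sub>0 nat) = keys s \<union> keys t"
  by (auto simp: in_keys_iff lookup_add)

lemma term_deg_superset:
  assumes "finite A" "keys t \<subseteq> A"
  shows "term_deg t = (\<Sum>i\<in>A. lookup t i)"
  unfolding term_deg_def using assms
  by (intro sum.mono_neutral_left) (auto simp: in_keys_iff)

lemma term_deg_plus: "term_deg (s + t) = term_deg s + term_deg t"
proof -
  let ?A = "keys s \<union> keys t"
  have "term_deg (s + t) = (\<Sum>i\<in>?A. lookup (s + t) i)"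
    by (rule term_deg_superset) (auto simp: keys_plus_nat)
  also have "\<dots> = term_deg s + term_deg t"
    by (simp add: lookup_add sum.distrib term_deg_superset[of ?A])
  finally show ?thesis .
qed

lemma term_deg_single [simp]: "term_deg (Poly_Mapping.single i k) = k"
  by (cases "k = 0") (auto simp: term_deg_def)

lemma term_deg_zero [simp]: "term_deg 0 = 0"
  by (simp add: term_deg_def)

lemma term_deg_var [simp]: "term_deg (var_exp i) = 1"
  by (simp add: var_exp_def)

lemma lookup_le_term_deg: "lookup t i \<le> term_deg t"
  by (cases "i \<in> keys t") (auto simp: term_deg_def in_keys_iff intro: member_le_sum)

lemma keys_var [simp]: "keys (var_exp i) = {i}"
  by (simp add: var_exp_def)

lemma lookup_var: "lookup (var_exp i) j = (if i = j then 1 else 0)"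
  by (simp add: var_exp_def lookup_single)

lemma var_plus_minus: "i \<in> keys t \<Longrightarrow> var_exp i + (t - var_exp i) = t" for t :: term_exp
  by (rule poly_mapping_eqI) (auto simp: lookup_add lookup_minus lookup_var in_keys_iff)

lemma terms_plus_iff: "s + t \<in> terms n \<longleftrightarrow> s \<in> terms n \<and> t \<in> terms n"
  by (auto simp: terms_def keys_plus_nat)

lemma var_in_terms [simp]: "var_exp i \<in> terms n \<longleftrightarrow> i \<le> n"
  by (simp add: terms_def)

lemma single_in_terms: "i \<le> n \<Longrightarrow> Poly_Mapping.single i k \<in> terms n"
  by (simp add: terms_def)

lemma zero_in_terms [simp]: "0 \<in> terms n"
  by (simp add: terms_def)

lemma poly_ring_0 [simp]: "0 \<in> poly_ring n"
  by (simp add: poly_ring_def)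

lemma poly_ring_add: "f \<in> poly_ring n \<Longrightarrow> g \<in> poly_ring n \<Longrightarrow> f + g \<in> poly_ring n"
  using Poly_Mapping.keys_add[of f g] by (auto simp: poly_ring_def)

lemma poly_ring_mult: "f \<in> poly_ring n \<Longrightarrow> g \<in> poly_ring n \<Longrightarrow> f * g \<in> poly_ring n"
  using Poly_Mapping.keys_mult[of f g] by (fastforce simp: poly_ring_def terms_plus_iff)

lemma poly_ring_single: "t \<in> terms n \<Longrightarrow> Poly_Mapping.single t c \<in> poly_ring n"
  by (auto simp: poly_ring_def)

lemma poly_ring_term [simp]: "term_poly t \<in> poly_ring n \<longleftrightarrow> t \<in> terms n"
  by (auto simp: poly_ring_def term_poly_def)

lemma poly_ring_const [simp]: "const_poly c \<in> poly_ring n"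
  by (simp add: const_poly_def poly_ring_single)

lemma lookup_single_mult_plus:
  fixes f :: "'k::field mpoly"
  shows "lookup (Poly_Mapping.single u c * f) (u + t) = c * lookup f t"
proof -
  have "lookup (Poly_Mapping.single u c * f) (u + t)
      = Sum_any (\<lambda>l. (c when u = l) * Sum_any (\<lambda>q. lookup f q when u + t = l + q))"
    by (simp add: lookup_mult prod_fun_def lookup_single)
  also have "\<dots> = Sum_any (\<lambda>l. (c * Sum_any (\<lambda>q. lookup f q when u + t = l + q)) when l = u)"
    by (intro Sum_any.cong) (auto simp: when_def)
  also have "\<dots> = c * lookup f t" by simp
  finally show ?thesis .
qed

lemma lookup_single_mult_0:
  fixes f :: "'k::field mpoly"
  assumes "\<And>t. s \<noteq> u + t"
  shows "lookup (Poly_Mapping.single u c * f) s = 0"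
proof (rule ccontr)
  assume "lookup (Poly_Mapping.single u c * f) s \<noteq> 0"
  then have "s \<in> keys (Poly_Mapping.single u c * f)"
    by (simp add: in_keys_iff)
  then obtain x y where "s = x + y" "x \<in> keys (Poly_Mapping.single u c)"
    using Poly_Mapping.keys_mult[of "Poly_Mapping.single u c" f] by blast
  then show False using assms by (auto split: if_splits)
qed

lemma lookup_var_mult:
  fixes f :: "'k::field mpoly"
  shows "lookup (term_poly (var_exp j) * f) t =
    (if j \<in> keys t then lookup f (t - var_exp j) else 0)"
proof (cases "j \<in> keys t")
  case True
  show ?thesis
    using lookup_single_mult_plus[of "var_exp j" 1 f "t - var_exp j"] True
    by (simp add: term_poly_def var_plus_minus)
next
  case False
  then show ?thesis
    unfolding term_poly_def
    by (auto intro!: lookup_single_mult_0 simp: keys_plus_nat)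
qed

lemma lookup_const_mult: "lookup (const_poly c * f) t = c * lookup f t"
  for f :: "'k::field mpoly"
  using lookup_single_mult_plus[of 0 c f t] by (simp add: const_poly_def)

lemma term_poly_mult: "term_poly s * term_poly t = (term_poly (s + t) :: 'k::field mpoly)"
  by (simp add: term_poly_def mult_single)

lemma const_poly_mult_term: "const_poly c * term_poly t = (Poly_Mapping.single t c :: 'k::field mpoly)"
  by (simp add: const_poly_def term_poly_def mult_single)

lemma mpoly_sum_single: "(\<Sum>s\<in>keys f. Poly_Mapping.single s (lookup f s)) = f"
  for f :: "'k::field mpoly"
  by (rule poly_mapping_eqI)
     (auto simp: lookup_sum lookup_single when_def in_keys_iff if_distrib sum.delta cong: if_cong)

section \<open>Closure properties of ideals\<close>

context
  fixes n :: nat and I :: "'k::field mpoly set"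
  assumes I: "is_ideal n I"
begin

lemma ideal_poly_ring: "f \<in> I \<Longrightarrow> f \<in> poly_ring n"
  using I by (auto simp: is_ideal_def)

lemma ideal_0: "0 \<in> I"
  using I by (auto simp: is_ideal_def)

lemma ideal_add: "f \<in> I \<Longrightarrow> g \<in> I \<Longrightarrow> f + g \<in> I"
  using I by (auto simp: is_ideal_def)

lemma ideal_mult: "f \<in> I \<Longrightarrow> h \<in> poly_ring n \<Longrightarrow> h * f \<in> I"
  using I by (auto simp: is_ideal_def)

lemma ideal_scale: "f \<in> I \<Longrightarrow> const_poly c * f \<in> I"
  by (auto intro: ideal_mult)

lemma ideal_diff: "f \<in> I \<Longrightarrow> g \<in> I \<Longrightarrow> f - g \<in> I"
  using ideal_add[of f "const_poly (- 1) * g"] ideal_scale[of g "- 1"]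
  by (simp add: const_poly_def single_uminus)

lemma ideal_sum: "(\<And>x. x \<in> A \<Longrightarrow> f x \<in> I) \<Longrightarrow> sum f A \<in> I"
  by (induction A rule: infinite_finite_induct) (auto intro: ideal_add ideal_0)

lemma ideal_term_plus: "term_poly t \<in> I \<Longrightarrow> s \<in> terms n \<Longrightarrow> term_poly (s + t) \<in> I"
  using ideal_mult[of "term_poly t" "term_poly s"] by (simp add: term_poly_mult)

lemma ideal_terms: "term_poly t \<in> I \<Longrightarrow> t \<in> terms n"
  using ideal_poly_ring by fastforce

end

section \<open>The Koszul complex\<close>

lemma card_insert_subset_atMost: "T \<subseteq> {..n::nat} \<Longrightarrow> j \<notin> T \<Longrightarrow> card (insert j T) = Suc (card T)"
  by (meson card_insert_disjoint finite_atMost finite_subset)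

lemma card_Diff_Min:
  fixes T :: "'a::linorder set"
  assumes "card T = Suc l"
  shows "card (T - {Min T}) = l"
proof -
  have "finite T" "T \<noteq> {}" using assms by (auto simp: card_ge_0_finite)
  then show ?thesis using assms by (simp add: card_Diff_singleton)
qed

text \<open>The sign with which \<open>e_j\<close> is moved to its place in \<open>e_T\<close>. Its
  values lie in an arbitrary ring, so that the same sign acts on polynomials and on
  coefficients.\<close>

definition ksgn :: "nat \<Rightarrow> nat set \<Rightarrow> 'a::ring_1" where
  "ksgn j T = (- 1) ^ card {l \<in> T. l < j}"

lemma lookup_ksgn_mult: "lookup (ksgn j T * f) b = ksgn j T * lookup f b"
  for f :: "'k::field mpoly"
  by (cases "even (card {l \<in> T. l < j})") (simp_all add: ksgn_def)

lemma ksgn_insert_greater: "l \<le> j \<Longrightarrow> ksgn l (insert j T) = ksgn l T"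
  unfolding ksgn_def by (rule arg_cong[where f = "\<lambda>A. (- 1) ^ card A"]) auto

lemma ksgn_insert_less:
  assumes "finite T" "j \<notin> T" "j < l"
  shows "ksgn l (insert j T) = - ksgn l T"
proof -
  have "{i \<in> insert j T. i < l} = insert j {i \<in> T. i < l}"
    using assms by auto
  then show ?thesis using assms by (simp add: ksgn_def)
qed

lemma ksgn_swap:
  assumes "finite T" "j \<notin> T" "l \<notin> T" "j \<noteq> l"
  shows "ksgn j T * ksgn l (insert j T) = - (ksgn l T * ksgn j (insert l T) :: 'a::comm_ring_1)"
  using assms by (cases "j < l") (auto simp: ksgn_insert_less ksgn_insert_greater)

text \<open>The Koszul differential read coefficientwise: a chain is the function taking
  \<open>T\<close> to its coefficient at \<open>e_T\<close>, and \<open>e_T\<close> receives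
  contributions from the sets with one more element. One function carries all exterior degrees at
  once; later statements select a degree through \<open>card T\<close>.\<close>

definition kd :: "nat \<Rightarrow> (nat set \<Rightarrow> 'k::field mpoly) \<Rightarrow> nat set \<Rightarrow> 'k mpoly" where
  "kd n z T = (\<Sum>j\<in>{..n} - T. ksgn j T * (term_poly (var_exp j) * z (insert j T)))"

lemma kd_cong:
  "(\<And>j. j \<le> n \<Longrightarrow> j \<notin> T \<Longrightarrow> z (insert j T) = w (insert j T)) \<Longrightarrow> kd n z T = kd n w T"
  unfolding kd_def by (intro sum.cong) auto

lemma kd_diff: "kd n (\<lambda>T. z T - w T) T = kd n z T - kd n w T"
  unfolding kd_def by (simp add: sum_subtractf right_diff_distrib)

lemma kd_linear: "kd n (\<lambda>T. \<Sum>q\<in>A. c q * z q T) T = (\<Sum>q\<in>A. c q * kd n (z q) T)"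
  unfolding kd_def sum_distrib_left sum_distrib_right
  by (subst sum.swap) (simp add: mult_ac)

text \<open>Exchanging the summation indices turns the part with \<open>l < j\<close> into the
  negative of the part with \<open>j < l\<close>. Comparing the whole sum with its own negative
  would only show that twice the sum is zero, which says nothing in characteristic 2.\<close>

lemma sum_antisymmetric:
  fixes \<phi> :: "'a::linorder \<Rightarrow> 'a \<Rightarrow> 'b::ab_group_add"
  assumes "finite U" and "\<And>j l. j \<in> U \<Longrightarrow> l \<in> U \<Longrightarrow> j \<noteq> l \<Longrightarrow> \<phi> j l = - \<phi> l j"
  shows "(\<Sum>j\<in>U. \<Sum>l\<in>U - {j}. \<phi> j l) = 0"
proof -
  have "(\<Sum>l\<in>U - {j}. \<phi> j l) = (\<Sum>l\<in>{l \<in> U. l < j}. \<phi> j l) + (\<Sum>l\<in>{l \<in> U. j < l}. \<phi> j l)"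
    if "j \<in> U" for j
    using assms(1) by (subst sum.union_disjoint[symmetric]) (auto intro!: sum.cong)
  then have "(\<Sum>j\<in>U. \<Sum>l\<in>U - {j}. \<phi> j l) =
      (\<Sum>j\<in>U. \<Sum>l\<in>{l \<in> U. l < j}. \<phi> j l) + (\<Sum>j\<in>U. \<Sum>l\<in>{l \<in> U. j < l}. \<phi> j l)"
    by (simp add: sum.distrib)
  also have "(\<Sum>j\<in>U. \<Sum>l\<in>{l \<in> U. l < j}. \<phi> j l) = (\<Sum>l\<in>U. \<Sum>j\<in>{j \<in> U. l < j}. \<phi> j l)"
    using assms(1) by (intro sum.swap_restrict) auto
  also have "\<dots> = (\<Sum>l\<in>U. \<Sum>j\<in>{j \<in> U. l < j}. - \<phi> l j)"
    using assms(2) by (intro sum.cong refl) auto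
  finally show ?thesis by (simp add: sum_negf)
qed

text \<open>Adjoining \<open>j\<close> and then \<open>l\<close> gives the same set as adjoining
  \<open>l\<close> and then \<open>j\<close>, with the opposite sign by
  \<open>ksgn_swap\<close>.\<close>

lemma kd_kd:
  assumes "T \<subseteq> {..n}"
  shows "kd n (kd n z) T = 0"
proof -
  let ?\<phi> = "\<lambda>j l. (ksgn j T * ksgn l (insert j T)) *
    (term_poly (var_exp j) * term_poly (var_exp l) * z (insert l (insert j T)))"
  have fin: "finite T" using assms finite_subset by blast
  have anti: "?\<phi> j l = - ?\<phi> l j" if "j \<in> {..n} - T" "l \<in> {..n} - T" "j \<noteq> l" for j l
  proof -
    have "ksgn j T * ksgn l (insert j T) = - (ksgn l T * ksgn j (insert l T) :: 'a mpoly)"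
      using that fin by (intro ksgn_swap) auto
    moreover have "term_poly (var_exp j) * term_poly (var_exp l) =
        term_poly (var_exp l) * (term_poly (var_exp j) :: 'a mpoly)"
      by (rule mult.commute)
    ultimately show ?thesis
      by (simp only: mult_minus_left insert_commute)
  qed
  have "kd n (kd n z) T = (\<Sum>j\<in>{..n} - T. \<Sum>l\<in>({..n} - T) - {j}. ?\<phi> j l)"
    unfolding kd_def sum_distrib_left
  proof (intro sum.cong refl)
    show "{..n} - insert j T = ({..n} - T) - {j}" for j by auto
  qed (simp only: mult.assoc mult.left_commute)
  also have "\<dots> = 0"
    using anti by (rule sum_antisymmetric[OF finite_Diff[OF finite_atMost]])
  finally show ?thesis .
qed

text \<open>
  The contracting homotopy \<open>khom\<close> replaces \<open>x\<^sup>s e\<^sub>T\<close> by \<open>x\<^sup>s/x\<^sub>k e\<^sub>T\<^sub>\<union>\<^sub>k\<close> when the least index \<open>k\<close>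
  occurring in \<open>s\<close> or \<open>T\<close> is not in \<open>T\<close>. Unlike the Euler homotopy it needs no division by
  the degree, so it works in every characteristic.
\<close>

definition kshift :: "nat \<Rightarrow> 'k::field mpoly \<Rightarrow> 'k mpoly" where
  "kshift k f = (\<Sum>s\<in>{s \<in> keys f. k \<in> keys s \<and> (\<forall>l\<in>keys s. k \<le> l)}.
     Poly_Mapping.single (s - var_exp k) (lookup f s))"

definition khom :: "(nat set \<Rightarrow> 'k::field mpoly) \<Rightarrow> nat set \<Rightarrow> 'k mpoly" where
  "khom z T = kshift (Min T) (z (T - {Min T}))"

lemma lookup_kshift:
  "lookup (kshift k f) b = (if \<forall>l\<in>keys b. k \<le> l then lookup f (var_exp k + b) else 0)"
proof -
  let ?A = "{s \<in> keys f. k \<in> keys s \<and> (\<forall>l\<in>keys s. k \<le> l)}"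
  have "lookup (kshift k f) b = (\<Sum>s\<in>?A. if s - var_exp k = b then lookup f s else 0)"
    by (simp add: kshift_def lookup_sum lookup_single when_def)
  also have "\<dots> = (\<Sum>s\<in>?A. if s = var_exp k + b then lookup f s else 0)"
    by (intro sum.cong refl if_cong) (auto simp: var_plus_minus)
  also have "\<dots> = (if var_exp k + b \<in> ?A then lookup f (var_exp k + b) else 0)"
    by (subst sum.delta) auto
  also have "\<dots> = (if \<forall>l\<in>keys b. k \<le> l then lookup f (var_exp k + b) else 0)"
    by (auto simp: keys_plus_nat in_keys_iff)
  finally show ?thesis .
qed

text \<open>Coefficients are compared at each \<open>x^b e_T\<close>, according to whether the least
  index \<open>k\<close> occurring in \<open>T\<close> or \<open>b\<close> lies in \<open>T\<close>.
  If it does, the cycle condition at \<open>T - {k}\<close> yields the identity; if not, the summand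
  \<open>j = k\<close> alone does. The one coefficient outside both cases is the constant one at
  \<open>T = {}\<close>, which is assumed to vanish.\<close>

lemma kd_khom:
  assumes T: "T \<subseteq> {..n}" and z: "z T \<in> poly_ring n"
    and empty: "T = {} \<Longrightarrow> lookup (z {}) 0 = 0"
    and cycle: "T \<noteq> {} \<Longrightarrow> kd n z (T - {Min T}) = 0"
  shows "kd n (khom z) T = z T"
proof (rule poly_mapping_eqI)
  fix b
  have [simp]: "finite T" using T finite_subset by blast
  have L: "lookup (kd n (khom z) T) b = (\<Sum>j\<in>{..n} - T. ksgn j T * (if j \<in> keys b then
      if \<forall>l\<in>keys (b - var_exp j). Min (insert j T) \<le> l
      then lookup (z (insert j T - {Min (insert j T)})) (var_exp (Min (insert j T)) + (b - var_exp j))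
      else 0 else 0))" (is "_ = sum ?g _")
    by (simp add: kd_def khom_def lookup_sum lookup_ksgn_mult lookup_var_mult lookup_kshift
      cong: if_cong)
  define A where "A = T \<union> keys b"
  show "lookup (kd n (khom z) T) b = lookup (z T) b"
  proof (cases "A = {}")
    case True
    then show ?thesis using empty L by (auto simp: A_def)
  next
    case ne: False
    define k where "k = Min A"
    have [simp]: "finite A" by (simp add: A_def)
    have kA: "k \<in> A" and kmin: "\<And>l. l \<in> A \<Longrightarrow> k \<le> l"
      using ne by (auto simp: k_def)
    have diff_keys: "keys (b - var_exp j) \<subseteq> keys b" for j
      by (auto simp: in_keys_iff lookup_minus)
    show ?thesis
    proof (cases "k \<in> T")
      case True
      have MinT: "Min T = k"
        using True kmin by (intro Min_eqI) (auto simp: A_def)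
      have Minj: "Min (insert j T) = k" if "j \<in> keys b" for j
        using True kmin that by (intro Min_eqI) (auto simp: A_def)
      have set: "{..n} - (T - {k}) = insert k ({..n} - T)" using True T by auto
      \<comment> \<open>The cycle condition is read at \<open>x_k x^b\<close>: its summand
        \<open>j = k\<close> is the wanted coefficient of \<open>z T\<close>, and the others are the
        negatives of the summands of \<open>kd n (khom z) T\<close>.\<close>
      have "0 = lookup (kd n z (T - {k})) (var_exp k + b)"
        using cycle True MinT by force
      also have "\<dots> = (\<Sum>j\<in>insert k ({..n} - T). ksgn j (T - {k}) *
          (if j \<in> keys (var_exp k + b)
           then lookup (z (insert j (T - {k}))) (var_exp k + b - var_exp j) else 0))" (is "_ = sum ?h _")
        by (simp add: kd_def lookup_sum lookup_ksgn_mult lookup_var_mult set)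
      also have "\<dots> = ?h k + (\<Sum>j\<in>{..n} - T. ?h j)"
        using True by (subst sum.insert) auto
      also have "?h k = lookup (z T) b"
      proof -
        have no: "{l \<in> T - {k}. l < k} = {}" using kmin by (force simp: A_def)
        show ?thesis unfolding ksgn_def no using True by (simp add: keys_plus_nat insert_absorb)
      qed
      also have "(\<Sum>j\<in>{..n} - T. ?h j) = (\<Sum>j\<in>{..n} - T. - ?g j)"
      proof (intro sum.cong refl)
        fix j assume j: "j \<in> {..n} - T"
        then have "j \<noteq> k" using True by auto
        show "?h j = - ?g j"
        proof (cases "j \<in> keys b")
          case jb: True
          then have "k < j" using kmin[of j] \<open>j \<noteq> k\<close> by (auto simp: A_def)
          then have "ksgn j (insert k (T - {k})) = - ksgn j (T - {k})"
            by (intro ksgn_insert_less) auto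
          then have "ksgn j T = - (ksgn j (T - {k}) :: 'a)"
            using True by (simp add: insert_absorb)
          moreover have "\<forall>l\<in>keys (b - var_exp j). k \<le> l"
            using kmin diff_keys[of j] by (auto simp: A_def)
          moreover have "var_exp k + b - var_exp j = var_exp k + (b - var_exp j)"
            using jb by (intro poly_mapping_eqI)
              (auto simp: lookup_add lookup_minus lookup_var in_keys_iff)
          moreover have "insert j (T - {k}) = insert j T - {k}"
            using \<open>j \<noteq> k\<close> by auto
          ultimately show ?thesis
            using jb by (simp add: Minj keys_plus_nat)
        next
          case False
          then show ?thesis using \<open>j \<noteq> k\<close> by (simp add: keys_plus_nat)
        qed
      qed
      finally show ?thesis by (simp add: L sum_negf)
    next
      case False
      then have kb: "k \<in> keys b" using kA by (auto simp: A_def)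
      \<comment> \<open>For any other \<open>j\<close> in \<open>keys b\<close> the term
        \<open>x^b / x_j\<close> still contains \<open>x_k\<close>, and \<open>k\<close> is less
        than the minimum of \<open>insert j T\<close>; so \<open>kshift\<close> discards it.\<close>
      have g: "?g j = (if j = k then lookup (z T) b else 0)" if "j \<in> {..n} - T" for j
      proof (cases "j = k")
        case True
        have "Min (insert k T) = k" using kmin by (intro Min_eqI) (auto simp: A_def)
        moreover have "ksgn k T = (1 :: 'a)"
        proof -
          have no: "{l \<in> T. l < k} = {}" using kmin by (force simp: A_def)
          show ?thesis unfolding ksgn_def no by simp
        qed
        moreover have "\<forall>l\<in>keys (b - var_exp k). k \<le> l"
          using kmin diff_keys[of k] by (auto simp: A_def)
        ultimately show ?thesis
          using True kb False by (simp add: var_plus_minus)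
      next
        case jk: False
        show ?thesis
        proof (cases "j \<in> keys b")
          case True
          have "\<forall>l\<in>insert j T. k < l"
            using jk False kmin True by (auto simp: A_def order_less_le)
          then have "k < Min (insert j T)"
            by (subst Min_gr_iff) auto
          moreover have "k \<in> keys (b - var_exp j)"
            using kb jk by (auto simp: in_keys_iff lookup_minus lookup_var)
          ultimately have nn: "\<not> (\<forall>l\<in>keys (b - var_exp j). Min (insert j T) \<le> l)"
            using leD by blast
          show ?thesis unfolding if_not_P[OF nn] using jk by simp
        qed (use jk in auto)
      qed
      \<comment> \<open>For \<open>k > n\<close> there is no summand \<open>j = k\<close>, but then
        \<open>x^b\<close> cannot occur in \<open>z T\<close> either.\<close>
      have "lookup (z T) b = 0" if "\<not> k \<le> n"
      proof -
        have "b \<notin> terms n" using that kb by (auto simp: terms_def)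
        then show ?thesis using z by (auto simp: poly_ring_def in_keys_iff)
      qed
      moreover have "sum ?g ({..n} - T) = (\<Sum>j\<in>{..n} - T. if j = k then lookup (z T) b else 0)"
        by (rule sum.cong[OF refl g])
      ultimately show ?thesis
        unfolding L using False by (subst (asm) sum.delta) auto
    qed
  qed
qed

section \<open>Koszul homology and graded resolutions\<close>

definition homog :: "nat \<Rightarrow> int \<Rightarrow> 'k::field mpoly \<Rightarrow> bool" where
  "homog n t f \<longleftrightarrow> f \<in> poly_ring n \<and> (\<forall>s\<in>keys f. int (term_deg s) = t)"

lemma homog_poly_ring: "homog n t f \<Longrightarrow> f \<in> poly_ring n"
  by (simp add: homog_def)

lemma homog_0 [simp]: "homog n t 0"
  by (simp add: homog_def)

lemma homog_add: "homog n t f \<Longrightarrow> homog n t g \<Longrightarrow> homog n t (f + g)"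
  using Poly_Mapping.keys_add[of f g] by (auto simp: homog_def poly_ring_add)

lemma poly_ring_ksgn_mult: "f \<in> poly_ring n \<Longrightarrow> ksgn j T * f \<in> poly_ring n"
  by (auto simp: poly_ring_def in_keys_iff lookup_ksgn_mult)

lemma homog_ksgn_mult: "homog n t f \<Longrightarrow> homog n t (ksgn j T * f)"
  by (auto simp: homog_def in_keys_iff lookup_ksgn_mult poly_ring_ksgn_mult)

lemma homog_diff: "homog n t f \<Longrightarrow> homog n t g \<Longrightarrow> homog n t (f - g)"
proof -
  assume f: "homog n t f" and g: "homog n t g"
  have "keys (f - g) \<subseteq> keys f \<union> keys g"
    by (auto simp: in_keys_iff lookup_minus)
  with f g show ?thesis by (auto simp: homog_def poly_ring_def)
qed

lemma homog_sum: "(\<And>x. x \<in> A \<Longrightarrow> homog n t (f x)) \<Longrightarrow> homog n t (sum f A)"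
  by (induction A rule: infinite_finite_induct) (auto intro: homog_add)

lemma homog_mult: "homog n s f \<Longrightarrow> homog n t g \<Longrightarrow> u = s + t \<Longrightarrow> homog n u (f * g)"
  using Poly_Mapping.keys_mult[of f g]
  by (fastforce simp: homog_def poly_ring_mult term_deg_plus)

lemma homog_term: "t \<in> terms n \<Longrightarrow> homog n (int (term_deg t)) (term_poly t)"
  by (auto simp: homog_def term_poly_def poly_ring_def)

lemma homog_kd:
  assumes "\<And>j. j \<le> n \<Longrightarrow> j \<notin> T \<Longrightarrow> homog n (t - 1) (z (insert j T))"
  shows "homog n t (kd n z T)"
  unfolding kd_def using assms
  by (auto intro!: homog_sum homog_ksgn_mult homog_mult[OF homog_term])

lemma homog_khom:
  assumes "homog n t (z (T - {Min T}))"
  shows "homog n (t - 1) (khom z T)"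
proof -
  have "b \<in> terms n \<and> int (term_deg b) = t - 1" if "b \<in> keys (khom z T)" for b
  proof -
    have "var_exp (Min T) + b \<in> keys (z (T - {Min T}))"
      using that by (auto simp: khom_def in_keys_iff lookup_kshift split: if_splits)
    then have "var_exp (Min T) + b \<in> terms n" "int (term_deg (var_exp (Min T) + b)) = t"
      using assms by (auto simp: homog_def poly_ring_def)
    then show ?thesis by (auto simp: terms_plus_iff term_deg_plus)
  qed
  then show ?thesis by (auto simp: homog_def poly_ring_def)
qed

text \<open>\<open>hom_component\<close> with an integer degree, as the shifts may be negative.\<close>

definition hcomp :: "int \<Rightarrow> 'k::field mpoly \<Rightarrow> 'k mpoly" where
  "hcomp t f = (\<Sum>s\<in>{s \<in> keys f. int (term_deg s) = t}. Poly_Mapping.single s (lookup f s))"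

lemma lookup_hcomp: "lookup (hcomp t f) s = (if int (term_deg s) = t then lookup f s else 0)"
proof -
  have "lookup (hcomp t f) s =
      (\<Sum>u\<in>{u \<in> keys f. int (term_deg u) = t}. if u = s then lookup f u else 0)"
    by (simp add: hcomp_def lookup_sum lookup_single when_def)
  also have "\<dots> = (if int (term_deg s) = t then lookup f s else 0)"
    by (subst sum.delta) (auto simp: in_keys_iff)
  finally show ?thesis .
qed

lemma homog_hcomp: "f \<in> poly_ring n \<Longrightarrow> homog n t (hcomp t f)"
  by (auto simp: homog_def poly_ring_def in_keys_iff lookup_hcomp split: if_splits)

lemma hcomp_homog: "homog n t f \<Longrightarrow> hcomp t f = f"
  by (rule poly_mapping_eqI) (auto simp: homog_def lookup_hcomp in_keys_iff)

lemma hcomp_add: "hcomp t (f + g) = hcomp t f + hcomp t g"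
  by (rule poly_mapping_eqI) (simp add: lookup_hcomp lookup_add)

lemma hcomp_0 [simp]: "hcomp t 0 = 0"
  by (simp add: hcomp_def)

lemma hcomp_sum: "hcomp t (sum f A) = (\<Sum>x\<in>A. hcomp t (f x))"
  by (induction A rule: infinite_finite_induct) (auto simp: hcomp_add)

lemma hcomp_mult_single: "hcomp t (Poly_Mapping.single u c * g) =
  Poly_Mapping.single u c * hcomp (t - int (term_deg u)) (g :: 'k::field mpoly)"
proof (rule poly_mapping_eqI)
  fix b
  show "lookup (hcomp t (Poly_Mapping.single u c * g)) b =
    lookup (Poly_Mapping.single u c * hcomp (t - int (term_deg u)) g) b"
  proof (cases "\<exists>s. b = u + s")
    case True
    then show ?thesis by (auto simp: lookup_hcomp lookup_single_mult_plus term_deg_plus)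
  next
    case False
    then show ?thesis by (simp add: lookup_hcomp lookup_single_mult_0)
  qed
qed

lemma hcomp_mult:
  assumes "homog n s f"
  shows "hcomp t (f * g) = f * hcomp (t - s) g"
proof -
  have "hcomp t (f * g) = hcomp t ((\<Sum>u\<in>keys f. Poly_Mapping.single u (lookup f u)) * g)"
    by (simp add: mpoly_sum_single)
  also have "\<dots> = (\<Sum>u\<in>keys f. Poly_Mapping.single u (lookup f u) * hcomp (t - int (term_deg u)) g)"
    by (simp add: sum_distrib_right hcomp_sum hcomp_mult_single)
  also have "\<dots> = (\<Sum>u\<in>keys f. Poly_Mapping.single u (lookup f u) * hcomp (t - s) g)"
    using assms by (intro sum.cong) (auto simp: homog_def)
  also have "\<dots> = f * hcomp (t - s) g"
    by (simp add: mpoly_sum_single flip: sum_distrib_right)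
  finally show ?thesis .
qed

text \<open>
  A complex of graded free modules, with \<open>G\<^sub>0 = S\<close> in the application, exact at every
  \<open>G\<^sub>i\<^sub>+\<^sub>1\<close>. Elements of \<open>G\<^sub>i\<close> are functions \<open>v\<close> of which only the values \<open>v p\<close> with
  \<open>p < r i\<close> matter.
\<close>

locale graded_exact =
  fixes n :: nat and r :: "nat \<Rightarrow> nat" and b :: "nat \<Rightarrow> nat \<Rightarrow> int"
    and a :: "nat \<Rightarrow> nat \<Rightarrow> nat \<Rightarrow> 'k::field mpoly"
  assumes a_homog: "p < r i \<Longrightarrow> q < r (Suc i) \<Longrightarrow> homog n (b (Suc i) q - b i p) (a i p q)"
    and exact: "\<forall>q<r (Suc i). v q \<in> poly_ring n \<Longrightarrow>
      \<forall>p<r i. (\<Sum>q<r (Suc i). a i p q * v q) = 0 \<Longrightarrow>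
      \<exists>w. (\<forall>s<r (Suc (Suc i)). w s \<in> poly_ring n) \<and>
          (\<forall>q<r (Suc i). v q = (\<Sum>s<r (Suc (Suc i)). a (Suc i) q s * w s))"
    and complex: "\<forall>s<r (Suc (Suc i)). w s \<in> poly_ring n \<Longrightarrow> p < r i \<Longrightarrow>
      (\<Sum>q<r (Suc i). a i p q * (\<Sum>s<r (Suc (Suc i)). a (Suc i) q s * w s)) = 0"
begin

definition mp :: "nat \<Rightarrow> (nat \<Rightarrow> 'k mpoly) \<Rightarrow> nat \<Rightarrow> 'k mpoly" where
  "mp i v p = (\<Sum>q<r (Suc i). a i p q * v q)"

lemma mp_cong: "(\<And>q. q < r (Suc i) \<Longrightarrow> v q = w q) \<Longrightarrow> mp i v p = mp i w p"
  by (simp add: mp_def)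

lemma mp_diff: "mp i (\<lambda>q. v q - w q) p = mp i v p - mp i w p"
  by (simp add: mp_def right_diff_distrib sum_subtractf)

lemma mp_kd: "mp i (\<lambda>q. kd n (\<lambda>T. y T q) T) p = kd n (\<lambda>T. mp i (y T) p) T"
  unfolding mp_def by (rule kd_linear[symmetric])

lemma mp_mp: "\<forall>s<r (Suc (Suc i)). w s \<in> poly_ring n \<Longrightarrow> p < r i \<Longrightarrow> mp i (mp (Suc i) w) p = 0"
  unfolding mp_def by (rule complex)

lemma homog_mp:
  assumes "p < r i" "\<And>q. q < r (Suc i) \<Longrightarrow> homog n (t - b (Suc i) q) (v q)"
  shows "homog n (t - b i p) (mp i v p)"
  unfolding mp_def using assms by (auto intro!: homog_sum homog_mult[OF a_homog])

lemma hcomp_mp: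
  assumes "p < r i"
  shows "hcomp (t - b i p) (mp i w p) = mp i (\<lambda>q. hcomp (t - b (Suc i) q) (w q)) p"
  unfolding mp_def hcomp_sum using assms
  by (intro sum.cong refl) (simp add: hcomp_mult[OF a_homog])

text \<open>The maps are graded, so an arbitrary preimage of a homogeneous element stays a preimage
  when each coordinate is replaced by its component of the appropriate degree.\<close>

lemma homog_lift:
  assumes w: "\<And>q. q < r (Suc i) \<Longrightarrow> w q \<in> poly_ring n"
    and v: "\<And>p. p < r i \<Longrightarrow> v p = mp i w p" "\<And>p. p < r i \<Longrightarrow> homog n (t - b i p) (v p)"
  shows "\<exists>w'. (\<forall>q<r (Suc i). homog n (t - b (Suc i) q) (w' q)) \<and> (\<forall>p<r i. v p = mp i w' p)"
proof (intro exI[of _ "\<lambda>q. hcomp (t - b (Suc i) q) (w q)"] conjI allI impI)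
  fix p assume p: "p < r i"
  have "v p = hcomp (t - b i p) (v p)" using v(2)[OF p] by (simp add: hcomp_homog)
  also have "\<dots> = mp i (\<lambda>q. hcomp (t - b (Suc i) q) (w q)) p"
    by (simp add: v(1)[OF p] hcomp_mp[OF p])
  finally show "v p = mp i (\<lambda>q. hcomp (t - b (Suc i) q) (w q)) p" .
qed (use w in \<open>auto intro: homog_hcomp\<close>)

lemma exact_homog:
  assumes "\<And>q. q < r (Suc i) \<Longrightarrow> homog n (t - b (Suc i) q) (v q)"
    and "\<And>p. p < r i \<Longrightarrow> mp i v p = 0"
  shows "\<exists>w. (\<forall>s<r (Suc (Suc i)). homog n (t - b (Suc (Suc i)) s) (w s)) \<and>
    (\<forall>q<r (Suc i). v q = mp (Suc i) w q)"
proof -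
  obtain w where "\<forall>s<r (Suc (Suc i)). w s \<in> poly_ring n"
    "\<forall>q<r (Suc i). v q = mp (Suc i) w q"
    using exact[of i v] assms by (auto simp: mp_def homog_def)
  then show ?thesis using assms(1) by (intro homog_lift) auto
qed

text \<open>
  Vanishing of the Koszul homology of the image \<open>Z\<^sub>i\<close> of \<open>G\<^sub>i\<^sub>+\<^sub>1\<close> in degrees above
  \<open>m + i + k\<close>: dimension shifting along \<open>Z\<^sub>i\<^sub>+\<^sub>1 \<rightarrow> G\<^sub>i\<^sub>+\<^sub>1 \<rightarrow> Z\<^sub>i\<close> reduces \<open>k\<close> to \<open>0\<close>, where
  the statement says that \<open>Z\<^sub>i\<close> is generated in degrees at most \<open>m + i\<close>. Elements of \<open>Z\<^sub>i\<close> are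
  represented by preimages in \<open>G\<^sub>i\<^sub>+\<^sub>1\<close>.
\<close>

lemma koszul_vanishing:
  assumes shifts: "\<And>i q. q < r (Suc i) \<Longrightarrow> b (Suc i) q \<le> m + int i"
    and "\<And>T q. T \<subseteq> {..n} \<Longrightarrow> card T = k \<Longrightarrow> q < r (Suc i) \<Longrightarrow>
      homog n (t - int k - b (Suc i) q) (y T q)"
    and "\<And>T p. T \<subseteq> {..n} \<Longrightarrow> Suc (card T) = k \<Longrightarrow> p < r i \<Longrightarrow>
      kd n (\<lambda>T. mp i (y T) p) T = 0"
    and "t > m + int i + int k"
  shows "\<exists>u. (\<forall>T q. T \<subseteq> {..n} \<longrightarrow> card T = Suc k \<longrightarrow> q < r (Suc i) \<longrightarrow>
        homog n (t - int (Suc k) - b (Suc i) q) (u T q)) \<and>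
      (\<forall>T p. T \<subseteq> {..n} \<longrightarrow> card T = k \<longrightarrow> p < r i \<longrightarrow>
        mp i (y T) p = kd n (\<lambda>T. mp i (u T) p) T)"
  using assms(2-)
proof (induction k arbitrary: i y)
  case 0
  define u where "u = (\<lambda>T q. khom (\<lambda>T. y T q) T)"
  have y: "homog n (t - b (Suc i) q) (y {} q)" if "q < r (Suc i)" for q
    using 0(1)[of "{}" q] that by simp
  have "homog n (t - 1 - b (Suc i) q) (u T q)"
    if "T \<subseteq> {..n}" "card T = 1" "q < r (Suc i)" for T q
  proof -
    have e: "T - {Min T} = {}" using that(2) by (auto simp: card_1_singleton_iff)
    then have "homog n (t - b (Suc i) q - 1) (u T q)"
      unfolding u_def using y[OF that(3)] by (intro homog_khom) (simp only: e)
    then show ?thesis by (simp add: algebra_simps)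
  qed
  moreover have "mp i (y {}) p = kd n (\<lambda>T. mp i (u T) p) {}" if "p < r i" for p
  proof -
    have "y {} q = kd n (\<lambda>T. u T q) {}" if q: "q < r (Suc i)" for q
    proof -
      \<comment> \<open>As \<open>t > m + i\<close> and the shift is at most \<open>m + i\<close>,
        the polynomial \<open>y {} q\<close> has positive degree; this is what
        \<open>kd_khom\<close> requires at the empty set.\<close>
      have "lookup (y {} q) 0 = 0"
        using y[OF q] shifts[OF q] 0(3) by (force simp: homog_def in_keys_iff)
      then show ?thesis
        unfolding u_def using y[OF q] by (intro kd_khom[symmetric]) (auto simp: homog_def)
    qed
    then have "mp i (y {}) p = mp i (\<lambda>q. kd n (\<lambda>T. u T q) {}) p"
      by (rule mp_cong)
    then show ?thesis by (simp add: mp_kd)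
  qed
  moreover have "finite T" if "T \<subseteq> {..n}" for T
    using that finite_subset by blast
  ultimately show ?case by (intro exI[of _ u]) auto
next
  case (Suc k)
  \<comment> \<open>The connecting map: the Koszul boundary \<open>v\<close> of the lift
    \<open>y\<close> maps to zero in \<open>G_i\<close>, so exactness lifts it to a chain
    \<open>y'\<close> over \<open>G_{i+2}\<close>, one exterior degree lower. The induction
    hypothesis applies to \<open>y'\<close> with \<open>i + 1\<close> and \<open>k\<close>, since
    the bound on \<open>t\<close> depends only on the sum of the two.\<close>
  define v where "v = (\<lambda>T q. kd n (\<lambda>T. y T q) T)"
  have vh: "homog n (t - int k - b (Suc i) q) (v T q)"
    if "T \<subseteq> {..n}" "card T = k" "q < r (Suc i)" for T q
    unfolding v_def
  proof (rule homog_kd)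
    fix j assume "j \<le> n" "j \<notin> T"
    then have "homog n (t - int (Suc k) - b (Suc i) q) (y (insert j T) q)"
      using that by (intro Suc.prems(1)) (auto simp: card_insert_subset_atMost)
    then show "homog n (t - int k - b (Suc i) q - 1) (y (insert j T) q)"
      by (simp add: algebra_simps)
  qed
  have "\<exists>w. (\<forall>s<r (Suc (Suc i)). homog n (t - int k - b (Suc (Suc i)) s) (w s)) \<and>
      (\<forall>q<r (Suc i). v T q = mp (Suc i) w q)" if "T \<subseteq> {..n}" "card T = k" for T
  proof (rule exact_homog)
    show "mp i (v T) p = 0" if "p < r i" for p
      using Suc.prems(2)[of T p] \<open>T \<subseteq> {..n}\<close> \<open>card T = k\<close> that by (simp add: v_def mp_kd)
  qed (use that vh in auto)
  then obtain y' where
    y'h: "\<And>T s. T \<subseteq> {..n} \<Longrightarrow> card T = k \<Longrightarrow> s < r (Suc (Suc i)) \<Longrightarrow>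
      homog n (t - int k - b (Suc (Suc i)) s) (y' T s)"
    and y': "\<And>T q. T \<subseteq> {..n} \<Longrightarrow> card T = k \<Longrightarrow> q < r (Suc i) \<Longrightarrow> v T q = mp (Suc i) (y' T) q"
    by metis
  have cyc: "kd n (\<lambda>T. mp (Suc i) (y' T) q) T = 0"
    if "T \<subseteq> {..n}" "Suc (card T) = k" "q < r (Suc i)" for T q
  proof -
    have "kd n (\<lambda>T. mp (Suc i) (y' T) q) T = kd n (\<lambda>T. v T q) T"
      using that by (intro kd_cong y'[symmetric]) (auto simp: card_insert_subset_atMost)
    then show ?thesis using kd_kd[OF that(1)] by (simp add: v_def)
  qed
  have "\<exists>u. (\<forall>T q. T \<subseteq> {..n} \<longrightarrow> card T = Suc k \<longrightarrow> q < r (Suc (Suc i)) \<longrightarrow>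
        homog n (t - int (Suc k) - b (Suc (Suc i)) q) (u T q)) \<and>
      (\<forall>T p. T \<subseteq> {..n} \<longrightarrow> card T = k \<longrightarrow> p < r (Suc i) \<longrightarrow>
        mp (Suc i) (y' T) p = kd n (\<lambda>T. mp (Suc i) (u T) p) T)"
  proof (rule Suc.IH)
    show "t > m + int (Suc i) + int k" using Suc.prems(3) by simp
  qed (fact y'h, fact cyc)
  then obtain u' where
    u'h: "\<And>T s. T \<subseteq> {..n} \<Longrightarrow> card T = Suc k \<Longrightarrow> s < r (Suc (Suc i)) \<Longrightarrow>
      homog n (t - int (Suc k) - b (Suc (Suc i)) s) (u' T s)"
    and u': "\<And>T q. T \<subseteq> {..n} \<Longrightarrow> card T = k \<Longrightarrow> q < r (Suc i) \<Longrightarrow>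
      mp (Suc i) (y' T) q = kd n (\<lambda>T. mp (Suc i) (u' T) q) T"
    by blast
  \<comment> \<open>Subtracting the image of \<open>u'\<close> turns \<open>y\<close> into a Koszul
    cycle of the free module \<open>G_{i+1}\<close>, which \<open>khom\<close> bounds. The image in
    \<open>G_i\<close> does not change, since consecutive maps compose to zero.\<close>
  define z where "z = (\<lambda>T q. y T q - mp (Suc i) (u' T) q)"
  define u where "u = (\<lambda>T q. khom (\<lambda>T. z T q) T)"
  have zh: "homog n (t - int (Suc k) - b (Suc i) q) (z T q)"
    if "T \<subseteq> {..n}" "card T = Suc k" "q < r (Suc i)" for T q
    unfolding z_def using that by (intro homog_diff Suc.prems(1) homog_mp u'h) auto
  have zc: "kd n (\<lambda>T. z T q) T = 0" if "T \<subseteq> {..n}" "card T = k" "q < r (Suc i)" for T q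
    using u'[OF that] y'[OF that] by (simp add: z_def kd_diff v_def)
  show ?case
  proof (intro exI[of _ u] conjI allI impI)
    fix T q assume T: "T \<subseteq> {..n}" "card T = Suc (Suc k)" and q: "q < r (Suc i)"
    have "homog n (t - int (Suc k) - b (Suc i) q - 1) (u T q)"
      unfolding u_def using T q by (intro homog_khom zh card_Diff_Min) auto
    then show "homog n (t - int (Suc (Suc k)) - b (Suc i) q) (u T q)"
      by (simp add: algebra_simps)
  next
    fix T p assume T: "T \<subseteq> {..n}" "card T = Suc k" and p: "p < r i"
    have zu: "z T q = kd n (\<lambda>T. u T q) T" if q: "q < r (Suc i)" for q
      unfolding u_def
    proof (rule kd_khom[symmetric])
      show "z T q \<in> poly_ring n" using zh[OF T q] by (rule homog_poly_ring)
      show "kd n (\<lambda>T. z T q) (T - {Min T}) = 0"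
        using T q by (intro zc card_Diff_Min) auto
    qed (use T in auto)
    have "mp i (y T) p = mp i (z T) p + mp i (mp (Suc i) (u' T)) p"
      by (simp add: z_def mp_diff)
    also have "mp i (mp (Suc i) (u' T)) p = 0"
      using u'h[OF T] p by (intro mp_mp) (auto simp: homog_def)
    also have "mp i (z T) p = kd n (\<lambda>T. mp i (u T) p) T"
      using mp_cong[OF zu] by (simp add: mp_kd)
    finally show "mp i (y T) p = kd n (\<lambda>T. mp i (u T) p) T" by simp
  qed
qed

end

section \<open>Free resolutions as graded exact complexes\<close>

lemma mult_mat_vec_nth:
  assumes "M \<in> carrier_mat r s" "p < r" "v \<in> carrier_vec s"
  shows "(M *\<^sub>v v) $ p = (\<Sum>q<s. M $$ (p, q) * v $ q)"
  using assms by (auto simp: scalar_prod_def lessThan_atLeast0 intro!: sum.cong)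

context
  fixes n :: nat and I :: "'k::field mpoly set" and F :: "'k free_complex"
  assumes F: "graded_free_resolution n I F"
begin

text \<open>The resolution is prolonged by \<open>G_0 = S\<close> with \<open>augm\<close> as first
  map, so that exactness at \<open>F_0\<close> and at the later modules takes a single form.\<close>

definition "res_rank = (\<lambda>i. case i of 0 \<Rightarrow> 1 | Suc i \<Rightarrow> rank F i)"
definition "res_shift = (\<lambda>i. case i of 0 \<Rightarrow> (\<lambda>_. 0) | Suc i \<Rightarrow> shift F i)"
definition "res_mat = (\<lambda>i. case i of 0 \<Rightarrow> augm F | Suc i \<Rightarrow> diff F i)"

lemma res_graded:
  "graded_matrix n (res_rank i) (res_shift i) (res_rank (Suc i)) (res_shift (Suc i)) (res_mat i)"
  using F by (cases i) (simp_all add: graded_free_resolution_def res_rank_def res_shift_def res_mat_def)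

lemma res_carrier: "res_mat i \<in> carrier_mat (res_rank i) (res_rank (Suc i))"
  using res_graded by (simp add: graded_matrix_def)

lemma res_exact:
  "{v \<in> free_module n (res_rank (Suc i)). res_mat i *\<^sub>v v = 0\<^sub>v (res_rank i)} =
    (\<lambda>w. res_mat (Suc i) *\<^sub>v w) ` free_module n (res_rank (Suc (Suc i)))"
  using F by (cases i) (simp_all add: graded_free_resolution_def res_rank_def res_mat_def)

lemma res_image: "(\<lambda>v. (res_mat 0 *\<^sub>v v) $ 0) ` free_module n (res_rank (Suc 0)) = I"
  using F by (simp add: graded_free_resolution_def res_rank_def res_mat_def)

lemma vec_free_module: "\<forall>q<s. v q \<in> poly_ring n \<Longrightarrow> vec s v \<in> free_module n s"
  by (simp add: free_module_def)

lemma free_module_nth: "w \<in> free_module n s \<Longrightarrow> q < s \<Longrightarrow> w $ q \<in> poly_ring n"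
  by (simp add: free_module_def)

lemma free_module_carrier: "w \<in> free_module n s \<Longrightarrow> w \<in> carrier_vec s"
  by (simp add: free_module_def)

lemma res_graded_exact: "graded_exact n res_rank res_shift (\<lambda>i p q. res_mat i $$ (p, q))"
proof
  fix i p q assume "p < res_rank i" "q < res_rank (Suc i)"
  then show "homog n (res_shift (Suc i) q - res_shift i p) (res_mat i $$ (p, q))"
    using res_graded[of i] by (auto simp: graded_matrix_def homog_def)
next
  fix i and v :: "nat \<Rightarrow> 'k mpoly"
  let ?V = "vec (res_rank (Suc i)) v"
  assume v: "\<forall>q<res_rank (Suc i). v q \<in> poly_ring n"
    and 0: "\<forall>p<res_rank i. (\<Sum>q<res_rank (Suc i). res_mat i $$ (p, q) * v q) = 0"
  have "res_mat i *\<^sub>v ?V = 0\<^sub>v (res_rank i)"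
  proof (rule eq_vecI)
    fix p assume "p < dim_vec (0\<^sub>v (res_rank i) :: 'k mpoly vec)"
    then show "(res_mat i *\<^sub>v ?V) $ p = 0\<^sub>v (res_rank i) $ p"
      using 0 by (simp add: mult_mat_vec_nth[OF res_carrier] del: index_mult_mat_vec)
  qed (use res_carrier[of i] in auto)
  then have "?V \<in> (\<lambda>w. res_mat (Suc i) *\<^sub>v w) ` free_module n (res_rank (Suc (Suc i)))"
    using vec_free_module[OF v] by (simp flip: res_exact)
  then obtain w where w: "w \<in> free_module n (res_rank (Suc (Suc i)))" "?V = res_mat (Suc i) *\<^sub>v w"
    by blast
  have "v q = (\<Sum>s<res_rank (Suc (Suc i)). res_mat (Suc i) $$ (q, s) * w $ s)"
    if "q < res_rank (Suc i)" for q
  proof -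
    have "v q = ?V $ q" using that by simp
    also have "\<dots> = (res_mat (Suc i) *\<^sub>v w) $ q" by (simp only: w(2))
    finally show ?thesis
      using mult_mat_vec_nth[OF res_carrier that free_module_carrier[OF w(1)]] by simp
  qed
  then show "\<exists>w. (\<forall>s<res_rank (Suc (Suc i)). w s \<in> poly_ring n) \<and>
      (\<forall>q<res_rank (Suc i). v q = (\<Sum>s<res_rank (Suc (Suc i)). res_mat (Suc i) $$ (q, s) * w s))"
    using free_module_nth[OF w(1)] by (intro exI[of _ "\<lambda>s. w $ s"]) blast
next
  fix i p and w :: "nat \<Rightarrow> 'k mpoly"
  let ?W = "vec (res_rank (Suc (Suc i))) w"
  assume w: "\<forall>s<res_rank (Suc (Suc i)). w s \<in> poly_ring n" and p: "p < res_rank i"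
  have "res_mat (Suc i) *\<^sub>v ?W \<in>
      {v \<in> free_module n (res_rank (Suc i)). res_mat i *\<^sub>v v = 0\<^sub>v (res_rank i)}"
    using vec_free_module[OF w] unfolding res_exact by blast
  then have "(res_mat i *\<^sub>v (res_mat (Suc i) *\<^sub>v ?W)) $ p = 0"
    using p by simp
  moreover have "res_mat (Suc i) *\<^sub>v ?W \<in> carrier_vec (res_rank (Suc i))"
    using res_carrier by (intro mult_mat_vec_carrier) auto
  ultimately show "(\<Sum>q<res_rank (Suc i). res_mat i $$ (p, q) *
      (\<Sum>s<res_rank (Suc (Suc i)). res_mat (Suc i) $$ (q, s) * w s)) = 0"
    using p by (simp add: mult_mat_vec_nth[OF res_carrier] del: index_mult_mat_vec)
qed

interpretation graded_exact n res_rank res_shift "\<lambda>i p q. res_mat i $$ (p, q)"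
  by (rule res_graded_exact)

lemma mem_ideal_iff:
  "f \<in> I \<longleftrightarrow> (\<exists>v. (\<forall>q<res_rank 1. v q \<in> poly_ring n) \<and> f = mp 0 v 0)"
proof -
  have 0: "(res_mat 0 *\<^sub>v w) $ 0 = mp 0 (\<lambda>q. w $ q) 0" if "w \<in> carrier_vec (res_rank (Suc 0))" for w
  proof -
    have "0 < res_rank 0" by (simp add: res_rank_def)
    then show ?thesis
      unfolding mp_def by (rule mult_mat_vec_nth[OF res_carrier _ that])
  qed
  show ?thesis
  proof
    assume "f \<in> I"
    then obtain w where w: "w \<in> free_module n (res_rank (Suc 0))" "f = (res_mat 0 *\<^sub>v w) $ 0"
      using res_image by blast
    then show "\<exists>v. (\<forall>q<res_rank 1. v q \<in> poly_ring n) \<and> f = mp 0 v 0"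
      using 0[OF free_module_carrier[OF w(1)]] free_module_nth[OF w(1)]
      by (intro exI[of _ "\<lambda>q. w $ q"]) auto
  next
    assume "\<exists>v. (\<forall>q<res_rank 1. v q \<in> poly_ring n) \<and> f = mp 0 v 0"
    then obtain v where v: "\<forall>q<res_rank (Suc 0). v q \<in> poly_ring n" "f = mp 0 v 0"
      by auto
    have "f = (res_mat 0 *\<^sub>v vec (res_rank (Suc 0)) v) $ 0"
      unfolding v(2) by (subst 0) (auto intro: mp_cong)
    then show "f \<in> I"
      using vec_free_module[OF v(1)] res_image by blast
  qed
qed

text \<open>
  If \<open>f\<close> were not in \<open>I\<close>, then \<open>f e\<^sub>T\<close> would be a Koszul cycle of \<open>S/I\<close> that is not a
  boundary, in a degree where the Koszul homology of \<open>S/I\<close> vanishes.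
\<close>

lemma socle_degree:
  assumes shifts: "\<And>i j. j < rank F i \<Longrightarrow> shift F i j \<le> int m + int i"
    and is_ideal_I: "is_ideal n I"
    and T: "T \<subseteq> {..n}" "T \<noteq> {}"
    and f: "f \<in> terms n" "keys f \<subseteq> T" "m \<le> term_deg f"
    and soc: "\<And>j. j \<in> T \<Longrightarrow> term_poly (var_exp j + f) \<in> I"
  shows "\<exists>g\<in>I. lookup g f \<noteq> 0"
proof -
  have finT: "finite T" using T finite_subset by blast
  define k where "k = card T - 1"
  have cT: "card T = Suc k" using T finT by (simp add: k_def card_gt_0_iff)
  \<comment> \<open>The total degree of \<open>f e_T\<close>, whose boundary has exterior degree
    \<open>k\<close>. As \<open>f\<close> has degree at least \<open>m\<close>, it exceeds
    \<open>m + k\<close>, the bound of \<open>koszul_vanishing\<close> for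
    \<open>i = 0\<close>.\<close>
  define t where "t = int (term_deg f) + 1 + int k"
  define z :: "nat set \<Rightarrow> 'k mpoly" where "z = (\<lambda>U. if U = T then term_poly f else 0)"
  have r0: "res_rank 0 = 1" "res_shift 0 = (\<lambda>_. 0)"
    by (simp_all add: res_rank_def res_shift_def)
  have zh: "homog n (t - int (Suc k)) (z U)" for U
    using f(1) by (simp add: z_def t_def homog_term)
  have vh: "homog n (t - int k) (kd n z U)" for U
    using zh by (intro homog_kd) (simp add: algebra_simps)
  \<comment> \<open>The coefficients of the boundary of \<open>f e_T\<close> are zero or, up to
    sign, \<open>x_j f\<close> with \<open>j\<close> in \<open>T\<close>.\<close>
  have vI: "kd n z U \<in> I" for U
    unfolding kd_def
  proof (rule ideal_sum[OF is_ideal_I])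
    fix j assume "j \<in> {..n} - U"
    have "term_poly (var_exp j) * z (insert j U) \<in> I"
    proof (cases "insert j U = T")
      case True
      then show ?thesis using soc[of j] by (auto simp: z_def term_poly_mult)
    next
      case False
      then show ?thesis by (simp add: z_def ideal_0[OF is_ideal_I])
    qed
    moreover have scale: "ksgn j U * g = const_poly (ksgn j U) * g" for g :: "'k mpoly"
      by (rule poly_mapping_eqI) (simp add: lookup_ksgn_mult lookup_const_mult)
    ultimately show "ksgn j U * (term_poly (var_exp j) * z (insert j U)) \<in> I"
      unfolding scale by (intro ideal_scale[OF is_ideal_I])
  qed
  have "\<exists>w. (\<forall>q<res_rank (Suc 0). homog n (t - int k - res_shift (Suc 0) q) (w q)) \<and>
      kd n z U = mp 0 w 0" for U
  proof -
    obtain v where "\<forall>q<res_rank (Suc 0). v q \<in> poly_ring n" "kd n z U = mp 0 v 0"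
      using vI[of U] mem_ideal_iff by auto
    moreover have "homog n (t - int k - res_shift 0 p) (kd n z U)" for p
      using vh[of U] by (simp add: r0)
    ultimately have "\<exists>w. (\<forall>q<res_rank (Suc 0). homog n (t - int k - res_shift (Suc 0) q) (w q)) \<and>
        (\<forall>p<res_rank 0. kd n z U = mp 0 w p)"
      by (intro homog_lift[of 0 v "\<lambda>_. kd n z U" "t - int k"]) (simp_all add: r0(1))
    then obtain w where w: "\<forall>q<res_rank (Suc 0). homog n (t - int k - res_shift (Suc 0) q) (w q)"
      and "\<forall>p<res_rank 0. kd n z U = mp 0 w p"
      by (elim exE conjE)
    then have "kd n z U = mp 0 w 0" using r0(1) by simp
    with w show ?thesis by (intro exI[of _ w] conjI)
  qed
  then obtain y where
    yh: "\<And>U q. q < res_rank (Suc 0) \<Longrightarrow> homog n (t - int k - res_shift (Suc 0) q) (y U q)"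
    and y: "\<And>U. kd n z U = mp 0 (y U) 0"
    by metis
  \<comment> \<open>The boundary of \<open>f e_T\<close> is a Koszul cycle with coefficients in
    \<open>I\<close>, lifted to \<open>F_0\<close> by \<open>y\<close>. In this degree it must also
    bound a chain with coefficients in \<open>I\<close>, the one induced by
    \<open>u\<close>.\<close>
  have "\<exists>u. (\<forall>U q. U \<subseteq> {..n} \<longrightarrow> card U = Suc k \<longrightarrow> q < res_rank (Suc 0) \<longrightarrow>
        homog n (t - int (Suc k) - res_shift (Suc 0) q) (u U q)) \<and>
      (\<forall>U p. U \<subseteq> {..n} \<longrightarrow> card U = k \<longrightarrow> p < res_rank 0 \<longrightarrow>
        mp 0 (y U) p = kd n (\<lambda>U. mp 0 (u U) p) U)"
  proof (rule koszul_vanishing)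
    show "res_shift (Suc i) q \<le> int m + int i" if "q < res_rank (Suc i)" for i q
      using shifts that by (simp add: res_shift_def res_rank_def)
    show "int m + int 0 + int k < t" using f(3) by (simp add: t_def)
    fix U p assume "U \<subseteq> {..n}" "p < res_rank 0"
    then have "kd n (\<lambda>U. mp 0 (y U) p) U = kd n (kd n z) U"
      by (intro kd_cong) (simp add: y r0)
    then show "kd n (\<lambda>U. mp 0 (y U) p) U = 0" using kd_kd \<open>U \<subseteq> {..n}\<close> by simp
  qed (use yh in auto)
  then obtain u where
    uh: "\<forall>U q. U \<subseteq> {..n} \<longrightarrow> card U = Suc k \<longrightarrow> q < res_rank (Suc 0) \<longrightarrow>
      homog n (t - int (Suc k) - res_shift (Suc 0) q) (u U q)"
    and "\<forall>U p. U \<subseteq> {..n} \<longrightarrow> card U = k \<longrightarrow> p < res_rank 0 \<longrightarrow>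
      mp 0 (y U) p = kd n (\<lambda>U. mp 0 (u U) p) U"
    by (elim exE conjE)
  then have u: "mp 0 (y U) 0 = kd n (\<lambda>U. mp 0 (u U) 0) U" if "U \<subseteq> {..n}" "card U = k" for U
    using that r0(1) by simp
  have uT: "homog n (t - int (Suc k) - res_shift (Suc 0) q) (u T q)" if "q < res_rank (Suc 0)" for q
    using uh T(1) cT that by blast
  define g where "g = mp 0 (u T) 0"
  have gI: "g \<in> I"
    unfolding mem_ideal_iff g_def using uT by (auto simp: homog_def)
  \<comment> \<open>The difference of the two chains is a cycle, hence a boundary over
    \<open>S\<close>. At \<open>e_T\<close> a boundary has only terms divisible by some
    \<open>x_j\<close> with \<open>j\<close> outside \<open>T\<close>, and \<open>f\<close> is not
    of this kind. So \<open>g\<close>, the coefficient at \<open>e_T\<close> of the chain over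
    \<open>I\<close>, contains \<open>f\<close> with coefficient 1.\<close>
  define z' where "z' = (\<lambda>U. z U - mp 0 (u U) 0)"
  have "z' T = kd n (khom z') T"
  proof (rule kd_khom[symmetric])
    show "z' T \<in> poly_ring n"
    proof -
      have "homog n (t - int (Suc k) - res_shift 0 0) (mp 0 (u T) 0)"
        using uT r0(1) by (intro homog_mp) simp_all
      then have "homog n (t - int (Suc k)) (z T - mp 0 (u T) 0)"
        using zh[of T] by (intro homog_diff) (simp_all only: r0(2) diff_zero)
      then show ?thesis unfolding z'_def by (rule homog_poly_ring)
    qed
    have "T - {Min T} \<subseteq> {..n}" using T by auto
    then show "kd n z' (T - {Min T}) = 0"
      using u[OF _ card_Diff_Min[OF cT]] by (simp add: z'_def kd_diff flip: y)
  qed (use T in auto)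
  moreover have "lookup (kd n (khom z') T) f = 0"
    unfolding kd_def lookup_sum lookup_ksgn_mult lookup_var_mult using f(2)
    by (intro sum.neutral) auto
  ultimately have "lookup (term_poly f - g) f = 0"
    by (simp add: z'_def z_def g_def)
  then have "lookup g f = 1" by (simp add: lookup_minus term_poly_def)
  then show ?thesis by (intro bexI[OF _ gI]) simp
qed

end

section \<open>Borel-fixed ideals\<close>

lemma term_poly_var_power: "term_poly (var_exp i) ^ k = (term_poly (Poly_Mapping.single i k) :: 'k::field mpoly)"
  by (induction k) (simp_all add: term_poly_def var_exp_def mult_single flip: single_add)

lemma const_poly_power: "const_poly c ^ k = (const_poly (c ^ k) :: 'k::field mpoly)"
  by (induction k) (simp_all add: const_poly_def mult_single)

lemma const_poly_0 [simp]: "const_poly 0 = 0"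
  by (simp add: const_poly_def)

lemma const_poly_1 [simp]: "const_poly 1 = 1"
  by (simp add: const_poly_def)

lemma prod_single_single:
  "(\<Prod>i\<in>A. Poly_Mapping.single (t i) (c i)) =
    (Poly_Mapping.single (sum t A) (prod c A) :: 'k::field mpoly)"
  by (induction A rule: infinite_finite_induct) (simp_all add: mult_single)

lemma term_sum_single: "(\<Sum>i\<in>keys s. Poly_Mapping.single i (lookup s i)) = s" for s :: term_exp
  by (rule poly_mapping_eqI)
     (simp add: lookup_sum lookup_single when_def in_keys_iff)

lemma prod_var_powers:
  "(\<Prod>i\<in>keys s. (const_poly (c i) * term_poly (var_exp i)) ^ lookup s i) =
    (Poly_Mapping.single s (\<Prod>i\<in>keys s. c i ^ lookup s i) :: 'k::field mpoly)"
proof -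
  have "(const_poly (c i) * term_poly (var_exp i)) ^ lookup s i =
      Poly_Mapping.single (Poly_Mapping.single i (lookup s i)) (c i ^ lookup s i)" for i
    by (simp only: power_mult_distrib const_poly_power term_poly_var_power)
      (simp only: const_poly_mult_term)
  then show ?thesis by (simp add: prod_single_single term_sum_single)
qed

lemma invertible_upper_triangular:
  fixes A :: "'k::field mat"
  assumes A: "A \<in> carrier_mat N N" "upper_triangular A" and d: "\<And>i. i < N \<Longrightarrow> A $$ (i, i) \<noteq> 0"
  shows "invertible_mat A"
proof -
  have "0 \<notin> set (diag_mat A)"
    using d A(1) by (auto simp: diag_mat_def)
  then have "det A \<noteq> 0"
    using det_upper_triangular[OF A(2,1)] by simp
  then have "A \<in> Units (ring_mat TYPE('k) N ())"
    by (rule det_non_zero_imp_unit[OF A(1)])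
  then obtain B where "B \<in> carrier_mat N N" "B * A = 1\<^sub>m N" "A * B = 1\<^sub>m N"
    by (auto simp: Units_def ring_mat_def)
  then show ?thesis
    using A(1) unfolding invertible_mat_def inverts_mat_def square_mat.simps by auto
qed

text \<open>The nonzero polynomial \<open>X^a - X^b\<close> has only finitely many roots. In
  \<open>borel_monomial\<close> such a \<open>c\<close> is the diagonal entry that tells two
  exponents apart.\<close>

lemma ex_power_neq:
  assumes "infinite (UNIV :: 'k::field set)" "a \<noteq> b"
  shows "\<exists>c::'k. c \<noteq> 0 \<and> c ^ a \<noteq> c ^ b"
proof -
  define q :: "'k poly" where "q = monom 1 a - monom 1 b"
  have "coeff q a = 1" using assms(2) by (simp add: q_def)
  then have "q \<noteq> 0" by auto
  then have "finite (insert 0 {x. poly q x = 0})"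
    by (simp add: poly_roots_finite)
  then obtain c where "c \<notin> insert 0 {x. poly q x = 0}"
    using assms(1) ex_new_if_finite by blast
  then show ?thesis by (auto simp: q_def poly_monom)
qed

lemma borel_ideal: "borel_fixed_ideal n I \<Longrightarrow> is_ideal n I"
  by (simp add: borel_fixed_ideal_def)

context
  fixes n :: nat and I :: "'k::field mpoly set"
  assumes borel: "borel_fixed_ideal n I" and inf: "infinite (UNIV :: 'k set)"
begin

lemma borel_act:
  assumes "A \<in> carrier_mat (n + 1) (n + 1)" "upper_triangular A"
    "\<And>i. i \<le> n \<Longrightarrow> A $$ (i, i) \<noteq> 0" "f \<in> I"
  shows "gl_act n A f \<in> I"
proof -
  have "invertible_mat A"
    using assms(1-3) by (intro invertible_upper_triangular) auto
  then have "gl_act n A ` I = I"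
    using borel assms(1,2) by (simp add: borel_fixed_ideal_def)
  then show ?thesis using assms(4) by blast
qed

text \<open>Induction on the number of terms of \<open>f\<close>. If another term \<open>s'\<close>
  occurs, scale by \<open>c\<close> a variable \<open>x_l\<close> whose exponents in
  \<open>s\<close> and \<open>s'\<close> differ. The image of \<open>f\<close> minus the multiple of
  \<open>f\<close> that cancels \<open>s'\<close> lies in \<open>I\<close>, still contains
  \<open>s\<close> and has no new terms.\<close>

lemma borel_monomial:
  assumes "f \<in> I" "s \<in> keys f"
  shows "term_poly s \<in> I"
  using assms
proof (induction "card (keys f)" arbitrary: f rule: less_induct)
  case less
  have f: "f \<in> poly_ring n" using ideal_poly_ring[OF borel_ideal[OF borel]] less.prems by blast
  show ?case
  proof (cases "keys f = {s}")
    case True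
    then have "f = Poly_Mapping.single s (lookup f s)"
      using mpoly_sum_single[of f] by simp
    moreover have "const_poly (inverse (lookup f s)) * Poly_Mapping.single s (lookup f s) = term_poly s"
      using less.prems(2) by (simp add: const_poly_def term_poly_def mult_single in_keys_iff)
    ultimately show ?thesis using ideal_scale[OF borel_ideal[OF borel] less.prems(1)] by metis
  next
    case False
    then obtain s' where s': "s' \<in> keys f" "s' \<noteq> s" using less.prems by blast
    then obtain l where l: "lookup s l \<noteq> lookup s' l"
      by (metis poly_mapping_eqI)
    then obtain c :: 'k where c: "c \<noteq> 0" "c ^ lookup s l \<noteq> c ^ lookup s' l"
      using ex_power_neq[OF inf] by blast
    have ln: "l \<le> n"
    proof -
      have "keys s \<subseteq> {..n}" "keys s' \<subseteq> {..n}"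
        using f less.prems(2) s'(1) by (auto simp: poly_ring_def terms_def)
      moreover have "l \<in> keys s \<or> l \<in> keys s'" using l by (auto simp: in_keys_iff)
      ultimately show ?thesis by blast
    qed
    define D :: "'k mat" where
      "D = mat (n + 1) (n + 1) (\<lambda>(i, j). if i = j then if i = l then c else 1 else 0)"
    have row: "(\<Sum>j\<le>n. const_poly (D $$ (i, j)) * term_poly (var_exp j)) =
        const_poly (if i = l then c else 1) * term_poly (var_exp i)" if "i \<le> n" for i
    proof -
      have "(\<Sum>j\<le>n. const_poly (D $$ (i, j)) * term_poly (var_exp j)) =
          (\<Sum>j\<le>n. if j = i then const_poly (if i = l then c else 1) * term_poly (var_exp i) else 0)"
        using that by (intro sum.cong) (auto simp: D_def)
      then show ?thesis using that by simp
    qed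
    have act: "gl_act n D f = (\<Sum>u\<in>keys f. Poly_Mapping.single u (lookup f u * c ^ lookup u l))"
      unfolding gl_act_def poly_subst_def
    proof (intro sum.cong refl)
      fix u assume "u \<in> keys f"
      then have u: "keys u \<subseteq> {..n}" using f by (auto simp: poly_ring_def terms_def)
      have "(\<Prod>i\<in>keys u. (\<Sum>j\<le>n. const_poly (D $$ (i, j)) * term_poly (var_exp j)) ^ lookup u i) =
          (\<Prod>i\<in>keys u. (const_poly (if i = l then c else 1) * term_poly (var_exp i)) ^ lookup u i)"
        using u by (intro prod.cong refl arg_cong2[of _ _ _ _ "(^)"] row) auto
      also have "\<dots> = Poly_Mapping.single u (\<Prod>i\<in>keys u. (if i = l then c else 1) ^ lookup u i)"
        by (rule prod_var_powers)
      also have "(\<Prod>i\<in>keys u. (if i = l then c else 1) ^ lookup u i) =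
          (\<Prod>i\<in>keys u. if i = l then c ^ lookup u l else 1)"
        by (intro prod.cong) auto
      also have "\<dots> = c ^ lookup u l"
        by (simp add: in_keys_iff)
      finally show "const_poly (lookup f u) *
          (\<Prod>i\<in>keys u. (\<Sum>j\<le>n. const_poly (D $$ (i, j)) * term_poly (var_exp j)) ^ lookup u i) =
          Poly_Mapping.single u (lookup f u * c ^ lookup u l)"
        by (simp add: const_poly_def mult_single)
    qed
    define g where "g = gl_act n D f - const_poly (c ^ lookup s' l) * f"
    have g: "lookup g u = lookup f u * (c ^ lookup u l - c ^ lookup s' l)" for u
    proof -
      have "lookup (gl_act n D f) u = lookup f u * c ^ lookup u l"
        by (simp add: act lookup_sum lookup_single when_def in_keys_iff)
      then show ?thesis by (simp add: g_def lookup_minus lookup_const_mult right_diff_distrib mult.commute[of _ "lookup f u"])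
    qed
    have "gl_act n D f \<in> I"
      using less.prems(1) c(1) by (intro borel_act) (auto simp: D_def intro!: upper_triangularI)
    then have gI: "g \<in> I"
      unfolding g_def
      using ideal_diff[OF borel_ideal[OF borel]] ideal_scale[OF borel_ideal[OF borel] less.prems(1)] by blast
    have "keys g \<subseteq> keys f - {s'}"
      by (auto simp: in_keys_iff g)
    then have "card (keys g) < card (keys f)"
      using s'(1) by (intro psubset_card_mono) auto
    moreover have "s \<in> keys g"
      using less.prems(2) c by (simp add: in_keys_iff g)
    ultimately show ?thesis using less.hyps gI by blast
  qed
qed

lemma lookup_var_sum_power:
  assumes "i \<noteq> j"
  shows "lookup ((term_poly (var_exp i) + term_poly (var_exp j)) ^ a) (Poly_Mapping.single j a) = (1 :: 'k)"
proof (induction a)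
  case (Suc a)
  have "Poly_Mapping.single j (Suc a) - var_exp j = Poly_Mapping.single j a"
    by (rule poly_mapping_eqI) (simp add: lookup_minus lookup_single lookup_var when_def)
  then show ?case
    using Suc assms by (simp add: distrib_right lookup_add lookup_var_mult)
qed simp

text \<open>
  The coefficient used is that of the extreme term of \<open>(x\<^sub>i + x\<^sub>j)\<^sup>a\<close>, which is \<open>1\<close>; the
  other binomial coefficients may vanish in positive characteristic.
\<close>

lemma borel_replace:
  assumes I: "term_poly (Poly_Mapping.single i a + u) \<in> I" and u: "i \<notin> keys u"
    and ij: "i < j" "j \<le> n"
  shows "term_poly (Poly_Mapping.single j a + u) \<in> I"
proof (cases "a = 0")
  case False
  \<comment> \<open>\<open>P\<close> sends \<open>x_i\<close> to \<open>x_i + x_j\<close> and fixes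
    the other variables; it is upper triangular because \<open>i < j\<close>. As \<open>x_i\<close>
    does not occur in \<open>u\<close>, the image of \<open>x_i^a u\<close> is
    \<open>u (x_i + x_j)^a\<close>.\<close>
  define P :: "'k mat" where
    "P = mat (n + 1) (n + 1) (\<lambda>(r, s). if r = s \<or> r = i \<and> s = j then 1 else 0)"
  let ?\<sigma> = "\<lambda>r. \<Sum>s\<le>n. const_poly (P $$ (r, s)) * term_poly (var_exp s)"
  have keys: "keys (Poly_Mapping.single i a + u) = insert i (keys u)"
    using False by (simp add: keys_plus_nat)
  have un: "keys u \<subseteq> {..n}"
    using ideal_terms[OF borel_ideal[OF borel] I] unfolding terms_plus_iff by (simp add: terms_def)
  have \<sigma>: "?\<sigma> r = term_poly (var_exp r)" if "r \<noteq> i" "r \<le> n" for r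
  proof -
    have "?\<sigma> r = (\<Sum>s\<le>n. if s = r then term_poly (var_exp r) else 0)"
      using that by (intro sum.cong) (auto simp: P_def)
    then show ?thesis using that by simp
  qed
  have \<sigma>i: "?\<sigma> i = term_poly (var_exp i) + term_poly (var_exp j)"
  proof -
    have "?\<sigma> i = (\<Sum>s\<le>n. (if s = i then term_poly (var_exp i) else 0) +
        (if s = j then term_poly (var_exp j) else 0))"
      using ij by (intro sum.cong) (auto simp: P_def)
    then show ?thesis using ij by (simp add: sum.distrib)
  qed
  have "gl_act n P (term_poly (Poly_Mapping.single i a + u)) =
      (\<Prod>r\<in>insert i (keys u). ?\<sigma> r ^ lookup (Poly_Mapping.single i a + u) r)"
    by (simp add: gl_act_def poly_subst_def term_poly_def keys flip: const_poly_def)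
  also have "\<dots> = ?\<sigma> i ^ a * (\<Prod>r\<in>keys u. ?\<sigma> r ^ lookup (Poly_Mapping.single i a + u) r)"
    using u by (subst prod.insert) (auto simp: lookup_add in_keys_iff)
  also have "(\<Prod>r\<in>keys u. ?\<sigma> r ^ lookup (Poly_Mapping.single i a + u) r) =
      (\<Prod>r\<in>keys u. (const_poly 1 * term_poly (var_exp r)) ^ lookup u r)"
  proof (intro prod.cong refl)
    fix r assume r: "r \<in> keys u"
    then have "r \<noteq> i" "r \<le> n" using u un by auto
    then show "?\<sigma> r ^ lookup (Poly_Mapping.single i a + u) r =
        (const_poly 1 * term_poly (var_exp r)) ^ lookup u r"
      by (simp add: \<sigma> lookup_add lookup_single)
  qed
  also have "\<dots> = Poly_Mapping.single u 1"
    by (subst prod_var_powers) simp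
  finally have "gl_act n P (term_poly (Poly_Mapping.single i a + u)) =
      Poly_Mapping.single u 1 * (term_poly (var_exp i) + term_poly (var_exp j)) ^ a"
    unfolding \<sigma>i by (simp only: mult.commute)
  then have "lookup (gl_act n P (term_poly (Poly_Mapping.single i a + u)))
      (u + Poly_Mapping.single j a) = 1"
    using ij by (simp add: lookup_single_mult_plus lookup_var_sum_power)
  moreover have "gl_act n P (term_poly (Poly_Mapping.single i a + u)) \<in> I"
    using I ij by (intro borel_act) (auto simp: P_def intro!: upper_triangularI)
  ultimately show ?thesis
    using borel_monomial by (metis in_keys_iff one_neq_zero add.commute)
qed (use I in simp)

end

section \<open>Spans of terms and domination\<close>

lemma term_poly_inj: "inj (term_poly :: term_exp \<Rightarrow> 'k::field mpoly)"
  by (auto simp: inj_def term_poly_def dest: arg_cong[where f = "Poly_Mapping.keys"])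

lemma span_terms:
  "mpoly.span (term_poly ` A) = {f :: 'k::field mpoly. keys f \<subseteq> A}"
proof
  have "mpoly.subspace {f :: 'k mpoly. keys f \<subseteq> A}"
    by (auto simp: mpoly.subspace_def poly_scale_def in_keys_iff lookup_add lookup_const_mult
      subset_iff) (metis add_0)
  then show "mpoly.span (term_poly ` A) \<subseteq> {f :: 'k mpoly. keys f \<subseteq> A}"
    by (intro mpoly.span_minimal) (auto simp: term_poly_def)
  show "{f :: 'k mpoly. keys f \<subseteq> A} \<subseteq> mpoly.span (term_poly ` A)"
  proof
    fix f :: "'k mpoly" assume f: "f \<in> {f. keys f \<subseteq> A}"
    have "(\<Sum>s\<in>keys f. poly_scale (lookup f s) (term_poly s)) \<in> mpoly.span (term_poly ` A)"
      using f by (intro mpoly.span_sum mpoly.span_scale mpoly.span_base) auto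
    then show "f \<in> mpoly.span (term_poly ` A)"
      by (simp add: poly_scale_def const_poly_mult_term mpoly_sum_single)
  qed
qed

lemma span_terms_eq_iff:
  "mpoly.span (term_poly ` A) = (mpoly.span (term_poly ` B) :: 'k::field mpoly set) \<longleftrightarrow> A = B"
proof
  assume eq: "mpoly.span (term_poly ` A) = (mpoly.span (term_poly ` B) :: 'k mpoly set)"
  have "a \<in> A \<longleftrightarrow> (term_poly a :: 'k mpoly) \<in> mpoly.span (term_poly ` A)" for a A
    unfolding span_terms by (simp add: term_poly_def)
  then show "A = B" using eq by blast
qed simp

lemma dim_terms: "mpoly.dim (term_poly ` A :: 'k::field mpoly set) = card A"
proof -
  have "mpoly.independent (term_poly ` A :: 'k mpoly set)"
  proof
    assume "mpoly.dependent (term_poly ` A :: 'k mpoly set)"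
    then obtain a where a: "a \<in> A"
      and "(term_poly a :: 'k mpoly) \<in> mpoly.span (term_poly ` A - {term_poly a})"
      by (auto simp: mpoly.dependent_def)
    moreover have "term_poly ` A - {term_poly a :: 'k mpoly} = term_poly ` (A - {a})"
      by (auto dest: injD[OF term_poly_inj])
    ultimately have "keys (term_poly a :: 'k mpoly) \<subseteq> A - {a}"
      by (simp add: span_terms)
    then show False by (simp add: term_poly_def)
  qed
  then show ?thesis
    by (simp add: mpoly.dim_eq_card_independent card_image inj_on_subset[OF term_poly_inj])
qed

definition terms_of_deg :: "nat \<Rightarrow> nat \<Rightarrow> term_exp set" where
  "terms_of_deg n t = {s \<in> terms n. term_deg s = t}"

text \<open>For a monomial ideal these terms represent a basis of the degree \<open>t\<close> part
  of \<open>S/I\<close>.\<close>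

definition std_terms :: "nat \<Rightarrow> 'k::field mpoly set \<Rightarrow> nat \<Rightarrow> term_exp set" where
  "std_terms n I t = {s \<in> terms_of_deg n t. term_poly s \<notin> I}"

lemma finite_bounded_terms: "finite {s \<in> terms n. \<forall>i\<le>n. lookup s i \<le> B}"
proof -
  let ?A = "{s \<in> terms n. \<forall>i\<le>n. lookup s i \<le> B}"
  have "(\<lambda>s. map (lookup s) [0..<Suc n]) ` ?A \<subseteq> {xs. set xs \<subseteq> {..B} \<and> length xs = Suc n}"
    by (auto simp del: upt_Suc)
  then have "finite ((\<lambda>s. map (lookup s) [0..<Suc n]) ` ?A)"
    by (rule finite_subset) (simp add: finite_lists_length_eq)
  moreover have "inj_on (\<lambda>s. map (lookup s) [0..<Suc n]) ?A"
  proof (rule inj_onI)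
    fix s u assume s: "s \<in> ?A" and u: "u \<in> ?A"
      and eq: "map (lookup s) [0..<Suc n] = map (lookup u) [0..<Suc n]"
    have "lookup s i = lookup u i" for i
    proof (cases "i \<le> n")
      case True
      then have "i \<in> set [0..<Suc n]" by (simp del: upt_Suc)
      then show ?thesis using eq by (metis map_eq_conv)
    next
      case False
      then have "i \<notin> keys s" "i \<notin> keys u" using s u by (auto simp: terms_def)
      then show ?thesis by (simp add: in_keys_iff)
    qed
    then show "s = u" by (rule poly_mapping_eqI)
  qed
  ultimately show ?thesis by (rule finite_imageD)
qed

lemma finite_terms_of_deg: "finite (terms_of_deg n t)"
  by (rule finite_subset[OF _ finite_bounded_terms[of n t]])
     (auto simp: terms_of_deg_def lookup_le_term_deg)

lemma graded_piece_span: "graded_piece n t = mpoly.span (term_poly ` terms_of_deg n t)"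
  by (auto simp: span_terms graded_piece_def poly_ring_def terms_of_deg_def)

lemma ideal_piece_span:
  assumes "is_ideal n I" and mon: "\<And>f s. f \<in> I \<Longrightarrow> s \<in> keys f \<Longrightarrow> term_poly s \<in> I"
  shows "ideal_piece n I t = mpoly.span (term_poly ` (terms_of_deg n t - std_terms n I t))"
proof -
  have "f \<in> I" if "\<And>s. s \<in> keys f \<Longrightarrow> term_poly s \<in> I" for f
  proof -
    have "(\<Sum>s\<in>keys f. const_poly (lookup f s) * term_poly s) \<in> I"
      using that by (intro ideal_sum[OF assms(1)] ideal_scale[OF assms(1)])
    then show ?thesis by (simp add: const_poly_mult_term mpoly_sum_single)
  qed
  then have "f \<in> I \<longleftrightarrow> keys f \<subseteq> {s. term_poly s \<in> I}" for f
    using mon by blast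
  moreover have "terms_of_deg n t - std_terms n I t = terms_of_deg n t \<inter> {s. term_poly s \<in> I}"
    by (auto simp: std_terms_def)
  ultimately show ?thesis
    unfolding ideal_piece_def graded_piece_span span_terms by blast
qed

lemma hilbert_function_eq_card:
  assumes "is_ideal n I" "\<And>f s. f \<in> I \<Longrightarrow> s \<in> keys f \<Longrightarrow> term_poly s \<in> I"
  shows "hilbert_function n I t = card (std_terms n I t)"
proof -
  have "std_terms n I t \<subseteq> terms_of_deg n t"
    by (auto simp: std_terms_def)
  then show ?thesis
    using finite_terms_of_deg[of n t] card_mono[OF finite_terms_of_deg]
    by (simp add: hilbert_function_def ideal_piece_span[OF assms] graded_piece_span dim_terms
        card_Diff_subset finite_subset)
qed

section \<open>Domination of finite sets by counting\<close>

lemma ex_maximum_on: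
  fixes f :: "'a \<Rightarrow> 'b::linorder"
  assumes "finite A" "A \<noteq> {}"
  shows "\<exists>a\<in>A. \<forall>x\<in>A. f x \<le> f a"
proof -
  have "Max (f ` A) \<in> f ` A" using assms by (intro Max_in) auto
  then obtain a where "a \<in> A" "Max (f ` A) = f a" by blast
  then show ?thesis using assms(1) by (metis Max_ge finite_imageI imageI)
qed

text \<open>For the converse direction, match a maximal \<open>a\<close> in \<open>A\<close> with a
  maximal \<open>b\<close> in \<open>B\<close>; the count at level \<open>f a\<close> gives
  \<open>f a \<le> f b\<close>. Removing both keeps the condition: levels up to \<open>f a\<close>
  lose one element on each side, and higher levels contain nothing of \<open>A\<close>.\<close>

lemma dominated_iff_card:
  fixes f :: "'a \<Rightarrow> nat"
  assumes "finite A" "finite B"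
  shows "(\<exists>\<omega>. bij_betw \<omega> A B \<and> (\<forall>a\<in>A. f a \<le> f (\<omega> a))) \<longleftrightarrow>
    card A = card B \<and> (\<forall>s. card {a \<in> A. s \<le> f a} \<le> card {b \<in> B. s \<le> f b})"
proof (intro iffI conjI allI)
  fix s
  assume "\<exists>\<omega>. bij_betw \<omega> A B \<and> (\<forall>a\<in>A. f a \<le> f (\<omega> a))"
  then obtain \<omega> where \<omega>: "bij_betw \<omega> A B" "\<And>a. a \<in> A \<Longrightarrow> f a \<le> f (\<omega> a)" by blast
  show "card A = card B" using \<omega>(1) by (rule bij_betw_same_card)
  show "card {a \<in> A. s \<le> f a} \<le> card {b \<in> B. s \<le> f b}"
  proof (rule card_inj_on_le)
    show "inj_on \<omega> {a \<in> A. s \<le> f a}"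
      using \<omega>(1) by (auto simp: bij_betw_def intro: inj_on_subset)
    show "\<omega> ` {a \<in> A. s \<le> f a} \<subseteq> {b \<in> B. s \<le> f b}"
      using \<omega> by (auto simp: bij_betw_def intro: order_trans)
  qed (use assms in auto)
next
  assume "card A = card B \<and> (\<forall>s. card {a \<in> A. s \<le> f a} \<le> card {b \<in> B. s \<le> f b})"
  then show "\<exists>\<omega>. bij_betw \<omega> A B \<and> (\<forall>a\<in>A. f a \<le> f (\<omega> a))"
    using assms
  proof (induction "card A" arbitrary: A B)
    case 0
    then show ?case by auto
  next
    case (Suc N)
    have ne: "A \<noteq> {}" "B \<noteq> {}" using Suc.hyps(2) Suc.prems by auto
    obtain a where a: "a \<in> A" "\<And>x. x \<in> A \<Longrightarrow> f x \<le> f a"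
      using ex_maximum_on[OF Suc.prems(2) ne(1)] by blast
    obtain b where b: "b \<in> B" "\<And>x. x \<in> B \<Longrightarrow> f x \<le> f b"
      using ex_maximum_on[OF Suc.prems(3) ne(2)] by blast
    have ab: "f a \<le> f b"
    proof -
      have "0 < card {x \<in> A. f a \<le> f x}"
        using a(1) Suc.prems(2) by (auto simp: card_gt_0_iff)
      also have "\<dots> \<le> card {x \<in> B. f a \<le> f x}" using Suc.prems(1) by blast
      finally obtain b' where "b' \<in> B" "f a \<le> f b'" by (auto simp: card_gt_0_iff)
      then show ?thesis using b(2) by (meson order_trans)
    qed
    have "card {x \<in> A - {a}. s \<le> f x} \<le> card {x \<in> B - {b}. s \<le> f x}" for s
    proof (cases "s \<le> f a")
      case True
      have "{x \<in> A. s \<le> f x} = insert a {x \<in> A - {a}. s \<le> f x}"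
        "{x \<in> B. s \<le> f x} = insert b {x \<in> B - {b}. s \<le> f x}"
        using True ab a(1) b(1) by auto
      moreover have "card {x \<in> A. s \<le> f x} \<le> card {x \<in> B. s \<le> f x}" using Suc.prems(1) by blast
      ultimately show ?thesis using Suc.prems(2,3) by simp
    next
      case False
      then have "{x \<in> A - {a}. s \<le> f x} = {}"
        using a(2) by (auto dest: order_trans)
      then show ?thesis by (simp only: card.empty)
    qed
    moreover have "card (A - {a}) = card (B - {b})" "N = card (A - {a})"
      using a(1) b(1) Suc.hyps(2) Suc.prems by auto
    ultimately obtain \<omega> where \<omega>: "bij_betw \<omega> (A - {a}) (B - {b})"
      "\<forall>x\<in>A - {a}. f x \<le> f (\<omega> x)"
      using Suc.hyps(1)[of "A - {a}" "B - {b}"] Suc.prems(2,3) by auto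
    have "bij_betw (\<omega>(a := b)) (A - {a}) (B - {b})"
      using \<omega>(1) by (subst bij_betw_cong[of _ _ \<omega>]) auto
    then have "bij_betw (\<omega>(a := b)) ((A - {a}) \<union> {a}) ((B - {b}) \<union> {(\<omega>(a := b)) a})"
      by (intro notIn_Un_bij_betw) auto
    moreover have "(A - {a}) \<union> {a} = A" "(B - {b}) \<union> {(\<omega>(a := b)) a} = B"
      using a(1) b(1) by auto
    ultimately have "bij_betw (\<omega>(a := b)) A B" by (simp only:)
    moreover have "\<forall>x\<in>A. f x \<le> f ((\<omega>(a := b)) x)"
      using \<omega>(2) ab by auto
    ultimately show ?case by blast
  qed
qed

lemma card_Diff_filter:
  assumes "finite U" "A \<subseteq> U"
  shows "card {x \<in> U - A. P x} = card {x \<in> U. P x} - card {x \<in> A. P x}"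
proof -
  have "{x \<in> U - A. P x} = {x \<in> U. P x} - {x \<in> A. P x}" by auto
  moreover have "{x \<in> A. P x} \<subseteq> {x \<in> U. P x}" using assms(2) by auto
  moreover have "finite {x \<in> A. P x}" using assms finite_subset by fastforce
  ultimately show ?thesis by (simp add: card_Diff_subset)
qed

definition dominated :: "('a \<times> 'a) set \<Rightarrow> 'a set \<Rightarrow> 'a set \<Rightarrow> bool" where
  "dominated ord A B \<longleftrightarrow> (\<exists>\<omega>. bij_betw \<omega> A B \<and> (\<forall>a\<in>A. (a, \<omega> a) \<in> ord))"

text \<open>The rank of \<open>x\<close> is the number of elements of \<open>U\<close> that are at
  most \<open>x\<close>. It carries the comparison over to natural numbers, where
  \<open>dominated_iff_card\<close> applies.\<close>

lemma ex_rank: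
  assumes "linear_order_on X ord" "finite U" "U \<subseteq> X"
  shows "\<exists>f :: 'a \<Rightarrow> nat. \<forall>x\<in>U. \<forall>y\<in>U. (x, y) \<in> ord \<longleftrightarrow> f x \<le> f y"
proof (intro exI ballI)
  let ?f = "\<lambda>x. card {z \<in> U. (z, x) \<in> ord}"
  have refl: "\<And>x. x \<in> X \<Longrightarrow> (x, x) \<in> ord" and tr: "trans ord"
    and tot: "total_on X ord"
    using assms(1)
    by (auto simp: linear_order_on_def partial_order_on_def preorder_on_def refl_on_def)
  fix x y assume x: "x \<in> U" and y: "y \<in> U"
  show "(x, y) \<in> ord \<longleftrightarrow> ?f x \<le> ?f y"
  proof
    assume "(x, y) \<in> ord"
    then show "?f x \<le> ?f y"
      using tr assms(2) by (intro card_mono) (auto dest: transD)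
  next
    assume le: "?f x \<le> ?f y"
    show "(x, y) \<in> ord"
    proof (rule ccontr)
      assume xy: "(x, y) \<notin> ord"
      then have yx: "(y, x) \<in> ord"
        using tot refl x y assms(3) by (metis subsetD total_on_def)
      have "x \<in> {z \<in> U. (z, x) \<in> ord} - {z \<in> U. (z, y) \<in> ord}"
        using x xy refl assms(3) by auto
      moreover have "{z \<in> U. (z, y) \<in> ord} \<subseteq> {z \<in> U. (z, x) \<in> ord}"
        using tr yx by (auto dest: transD)
      ultimately have "?f y < ?f x"
        using assms(2) by (intro psubset_card_mono) auto
      then show False using le by simp
    qed
  qed
qed

text \<open>Each count in a complement is the count in \<open>U\<close> minus the count in the set,
  so the inequalities of \<open>dominated_iff_card\<close> are reversed and the two sets exchange
  roles.\<close>

lemma dominated_Diff: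
  assumes "linear_order_on X ord" "finite U" "U \<subseteq> X" "A \<subseteq> U" "B \<subseteq> U"
  shows "dominated ord A B \<longleftrightarrow> dominated ord (U - B) (U - A)"
proof -
  obtain f :: "'a \<Rightarrow> nat" where f: "\<And>x y. x \<in> U \<Longrightarrow> y \<in> U \<Longrightarrow> (x, y) \<in> ord \<longleftrightarrow> f x \<le> f y"
    using ex_rank[OF assms(1-3)] by blast
  have eq: "dominated ord C D \<longleftrightarrow>
      card C = card D \<and> (\<forall>s. card {a \<in> C. s \<le> f a} \<le> card {b \<in> D. s \<le> f b})"
    if "C \<subseteq> U" "D \<subseteq> U" for C D
  proof -
    have "dominated ord C D \<longleftrightarrow> (\<exists>\<omega>. bij_betw \<omega> C D \<and> (\<forall>a\<in>C. f a \<le> f (\<omega> a)))"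
      unfolding dominated_def using that f
      by (intro arg_cong[where f = Ex] ext conj_cong refl ball_cong) (auto dest!: bij_betwE simp: subset_iff)
    then show ?thesis
      using dominated_iff_card[of C D f] that assms(2) by (simp add: finite_subset)
  qed
  have le: "card {x \<in> C. P x} \<le> card {x \<in> U. P x}" if "C \<subseteq> U" for C P
    using that assms(2) by (intro card_mono) auto
  have fin: "finite A" "finite B"
    using finite_subset[OF assms(4,2)] finite_subset[OF assms(5,2)] by auto
  have cards: "card (U - A) = card U - card A" "card (U - B) = card U - card B"
    "card A \<le> card U" "card B \<le> card U"
    using assms fin by (simp_all add: card_Diff_subset card_mono)
  have "card {x \<in> A. s \<le> f x} \<le> card {x \<in> B. s \<le> f x} \<longleftrightarrow>
      card {x \<in> U - B. s \<le> f x} \<le> card {x \<in> U - A. s \<le> f x}" for s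
    using card_Diff_filter[OF assms(2,4), of "\<lambda>x. s \<le> f x"]
      card_Diff_filter[OF assms(2,5), of "\<lambda>x. s \<le> f x"]
      le[OF assms(4), of "\<lambda>x. s \<le> f x"] le[OF assms(5), of "\<lambda>x. s \<le> f x"] by linarith
  then show ?thesis
    using eq[OF assms(4,5)] eq[of "U - B" "U - A"] cards by auto
qed

text \<open>The spanning sets of terms are determined by their spans, and a bijection between them
  gives the equality of dimensions.\<close>

lemma span_dominated_iff:
  assumes "A \<subseteq> terms_of_deg n t" "B \<subseteq> terms_of_deg n t"
  shows "span_dominated n t ord (mpoly.span (term_poly ` A) :: 'k::field mpoly set)
    (mpoly.span (term_poly ` B)) \<longleftrightarrow> dominated ord A B"
proof -
  have "card A = card B" if "bij_betw \<omega> A B" for \<omega>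
    using that by (rule bij_betw_same_card)
  then show ?thesis
    using assms
    by (auto simp: span_dominated_def span_terms_eq_iff dim_terms terms_of_deg_def dominated_def)
qed

section \<open>Domination and multiplication by a term\<close>

lemma term_order_cancel:
  assumes ord: "term_order n ord" and "s \<in> terms n" "t \<in> terms n" "u \<in> terms n"
  shows "(u + s, u + t) \<in> ord \<longleftrightarrow> (s, t) \<in> ord"
proof
  assume "(s, t) \<in> ord"
  then show "(u + s, u + t) \<in> ord" using assms by (auto simp: term_order_def)
next
  assume us: "(u + s, u + t) \<in> ord"
  have lin: "linear_order_on (terms n) ord" using ord by (simp add: term_order_def)
  show "(s, t) \<in> ord"
  proof (rule ccontr)
    assume st: "(s, t) \<notin> ord"
    moreover have "s \<noteq> t"
      using st lin assms(2) by (auto simp: linear_order_on_def partial_order_on_def preorder_on_def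
          refl_on_def)
    ultimately have "(t, s) \<in> ord"
      using lin assms(2,3) by (auto simp: linear_order_on_def partial_order_on_def preorder_on_def
          refl_on_def total_on_def)
    then have "(u + t, u + s) \<in> ord" using ord assms(4) by (auto simp: term_order_def)
    then have "u + s = u + t"
      using us lin antisymD by (fastforce simp only: linear_order_on_def partial_order_on_def)
    then show False using \<open>s \<noteq> t\<close> by simp
  qed
qed

text \<open>Bijections correspond by conjugation with multiplication by \<open>u\<close>;
  comparisons carry over by \<open>term_order_cancel\<close>.\<close>

lemma dominated_plus:
  assumes ord: "term_order n ord" and "A \<subseteq> terms n" "B \<subseteq> terms n" "u \<in> terms n"
  shows "dominated ord ((+) u ` A) ((+) u ` B) \<longleftrightarrow> dominated ord A B"
proof
  assume "dominated ord A B"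
  then obtain \<omega> where \<omega>: "bij_betw \<omega> A B" "\<And>a. a \<in> A \<Longrightarrow> (a, \<omega> a) \<in> ord"
    by (auto simp: dominated_def)
  have "bij_betw (\<lambda>x. u + \<omega> (x - u)) ((+) u ` A) ((+) u ` B)"
    using \<omega>(1) by (auto simp: bij_betw_def inj_on_def image_image)
  moreover have "\<omega> a \<in> terms n" if "a \<in> A" for a
    using bij_betwE[OF \<omega>(1)] that assms(3) by blast
  then have "\<forall>x\<in>(+) u ` A. (x, u + \<omega> (x - u)) \<in> ord"
    using \<omega>(2) assms(2,4) by (auto simp: term_order_cancel[OF ord])
  ultimately show "dominated ord ((+) u ` A) ((+) u ` B)"
    unfolding dominated_def by (intro exI[of _ "\<lambda>x. u + \<omega> (x - u)"] conjI)
next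
  assume "dominated ord ((+) u ` A) ((+) u ` B)"
  then obtain \<omega> where \<omega>: "bij_betw \<omega> ((+) u ` A) ((+) u ` B)"
    "\<And>a. a \<in> A \<Longrightarrow> (u + a, \<omega> (u + a)) \<in> ord"
    by (auto simp: dominated_def)
  have im: "\<exists>b\<in>B. \<omega> (u + a) = u + b" if "a \<in> A" for a
    using \<omega>(1) that by (auto simp: bij_betw_def)
  have "bij_betw ((\<lambda>x. x - u) \<circ> \<omega> \<circ> (+) u) A B"
  proof (intro bij_betw_trans)
    show "bij_betw ((+) u) A ((+) u ` A)" by (auto simp: bij_betw_def)
    show "bij_betw (\<lambda>x. x - u) ((+) u ` B) B"
      by (auto simp: bij_betw_def inj_on_def image_image)
  qed (fact \<omega>(1))
  moreover have "(a, \<omega> (u + a) - u) \<in> ord" if a: "a \<in> A" for a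
  proof -
    obtain b where b: "b \<in> B" "\<omega> (u + a) = u + b" using im[OF a] by blast
    then show ?thesis
      using \<omega>(2)[OF a] term_order_cancel[OF ord, of a b u] a assms by auto
  qed
  ultimately show "dominated ord A B"
    unfolding dominated_def by (intro exI[of _ "(\<lambda>x. x - u) \<circ> \<omega> \<circ> (+) u"]) auto
qed

section \<open>Standard terms of regular Borel-fixed ideals\<close>

text \<open>An infimum below \<open>m + 1\<close> is witnessed by an actual minimal resolution,
  whether or not it is attained. The values \<open>shift F i j - i\<close> are integers, so being
  below \<open>m + 1\<close> they are at most \<open>m\<close>.\<close>

lemma m_regular_resolution:
  assumes "m_regular n m I"
  shows "\<exists>F. graded_free_resolution n I F \<and> (\<forall>i j. j < rank F i \<longrightarrow> shift F i j \<le> int m + int i)"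
proof -
  have "cm_regularity n I < ereal (real m + 1)"
    using assms by (auto simp: m_regular_def intro: le_less_trans)
  then obtain F where F: "minimal_graded_free_resolution n I F"
    and lt: "(SUP (i, j)\<in>{(i, j). j < rank F i}. ereal (of_int (shift F i j - int i))) < ereal (real m + 1)"
    unfolding cm_regularity_def INF_less_iff by blast
  have "shift F i j \<le> int m + int i" if "j < rank F i" for i j
  proof -
    have "ereal (of_int (shift F i j - int i)) \<le>
        (SUP (i, j)\<in>{(i, j). j < rank F i}. ereal (of_int (shift F i j - int i)))"
      using that by (intro SUP_upper2[of "(i, j)"]) auto
    then have "ereal (of_int (shift F i j - int i)) < ereal (real m + 1)"
      using lt by (rule le_less_trans)
    then show ?thesis by simp
  qed
  then show ?thesis using F by (auto simp: minimal_graded_free_resolution_def)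
qed

context
  fixes n m :: nat and I :: "'k::field mpoly set" and d :: rat
  assumes borel: "borel_fixed_ideal n I" and inf: "infinite (UNIV :: 'k set)"
    and reg: "m_regular n m I" and hilb: "is_hilbert_polynomial n I [:d:]"
begin

lemmas is_ideal_I = borel_ideal[OF borel]

lemmas monomial = borel_monomial[OF borel inf]

text \<open>
  A term that is multiplied into \<open>I\<close> by powers of all the variables in \<open>T\<close> has a maximal
  multiple by variables in \<open>T\<close> outside \<open>I\<close>, to which \<open>socle_degree\<close> applies.
\<close>

lemma saturated_in_high_degree:
  assumes T: "T \<subseteq> {..n}" "T \<noteq> {}" and f: "f \<in> terms n" "keys f \<subseteq> T" "m \<le> term_deg f"
    and powers: "\<And>j. j \<in> T \<Longrightarrow> \<exists>N. term_poly (Poly_Mapping.single j N + f) \<in> I"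
  shows "term_poly f \<in> I"
proof (rule ccontr)
  assume fI: "term_poly f \<notin> I"
  have finT: "finite T" using T finite_subset by blast
  obtain N where N: "\<And>j. j \<in> T \<Longrightarrow> term_poly (Poly_Mapping.single j (N j) + f) \<in> I"
    using powers by metis
  define M where "M = {u \<in> terms n. keys u \<subseteq> T \<and> term_poly (u + f) \<notin> I}"
  \<comment> \<open>If the exponent of \<open>x_i\<close> in \<open>u\<close> reached
    \<open>N i\<close>, then \<open>u f\<close> would be a multiple of \<open>x_i^(N i) f\<close>,
    hence in \<open>I\<close>. This makes \<open>M\<close> finite and provides an element of maximal
    degree.\<close>
  have "lookup u i \<le> sum N T" if u: "u \<in> M" for u i
  proof (cases "i \<in> T")
    case True
    have "lookup u i < N i"
    proof (rule ccontr)
      assume "\<not> lookup u i < N i"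
      then have "u = (u - Poly_Mapping.single i (N i)) + Poly_Mapping.single i (N i)"
        by (intro poly_mapping_eqI) (auto simp: lookup_add lookup_minus lookup_single when_def)
      moreover from this have "u - Poly_Mapping.single i (N i) \<in> terms n"
        using u terms_plus_iff[of "u - Poly_Mapping.single i (N i)" "Poly_Mapping.single i (N i)" n]
        by (simp add: M_def)
      ultimately have "term_poly (u + f) \<in> I"
        using ideal_term_plus[OF is_ideal_I N[OF True]] by (metis add.assoc)
      then show False using u by (simp add: M_def)
    qed
    then show ?thesis using member_le_sum[of i T N] True finT by simp
  next
    case False
    then have "i \<notin> keys u" using u by (auto simp: M_def)
    then show ?thesis by (simp add: in_keys_iff)
  qed
  then have "finite M"
    by (intro finite_subset[OF _ finite_bounded_terms[of n "sum N T"]]) (auto simp: M_def)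
  moreover have "0 \<in> M" using fI by (simp add: M_def)
  ultimately obtain u where u: "u \<in> M" and max: "\<And>v. v \<in> M \<Longrightarrow> term_deg v \<le> term_deg u"
    using ex_maximum_on[of M term_deg] by blast
  obtain F where F: "graded_free_resolution n I F"
    "\<And>i j. j < rank F i \<Longrightarrow> shift F i j \<le> int m + int i"
    using m_regular_resolution[OF reg] by blast
  have "\<exists>g\<in>I. lookup g (u + f) \<noteq> 0"
  proof (rule socle_degree[OF F is_ideal_I T])
    show "u + f \<in> terms n" "keys (u + f) \<subseteq> T"
      using u f by (auto simp: M_def terms_plus_iff keys_plus_nat)
    show "m \<le> term_deg (u + f)" using f(3) by (simp add: term_deg_plus)
    fix j assume j: "j \<in> T"
    have "var_exp j + u \<notin> M" using max[of "var_exp j + u"] by (auto simp: term_deg_plus)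
    then show "term_poly (var_exp j + (u + f)) \<in> I"
      using u j T by (auto simp: M_def terms_plus_iff keys_plus_nat add.assoc)
  qed
  then have "term_poly (u + f) \<in> I" using monomial by (auto simp: in_keys_iff)
  then show False using u by (simp add: M_def)
qed

text \<open>Write \<open>t = x_0^a u\<close> with \<open>u\<close> free of \<open>x_0\<close>.
  Exchanging the whole power in \<open>x_0^(a+1) u\<close> for one of \<open>x_j\<close> and
  multiplying by \<open>x_0^a\<close> shows that \<open>x_j^(a+1) t\<close> is in \<open>I\<close>
  for every \<open>j > 0\<close>, so the socle argument applies with all variables.\<close>

lemma ideal_colon_x0:
  assumes t: "term_poly (var_exp 0 + t) \<in> I" and deg: "m \<le> term_deg t"
  shows "term_poly t \<in> I"
proof (rule saturated_in_high_degree[of "{..n}"])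
  define a where "a = lookup t 0"
  define u where "u = t - Poly_Mapping.single 0 a"
  have tu: "t = Poly_Mapping.single 0 a + u"
    by (rule poly_mapping_eqI) (auto simp: u_def a_def lookup_add lookup_minus lookup_single when_def)
  have tu': "var_exp 0 + t = Poly_Mapping.single 0 (Suc a) + u"
    by (simp add: tu var_exp_def add.assoc flip: single_add)
      (simp flip: single_add add.assoc)
  have u: "0 \<notin> keys u" by (simp add: u_def a_def in_keys_iff lookup_minus)
  show "t \<in> terms n"
    using ideal_terms[OF is_ideal_I t] by (simp add: terms_plus_iff)
  then show "keys t \<subseteq> {..n}" by (simp add: terms_def)
  fix j assume "j \<in> {..n}"
  show "\<exists>N. term_poly (Poly_Mapping.single j N + t) \<in> I"
  proof (cases "j = 0")
    case True
    then show ?thesis using t by (auto simp: var_exp_def)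
  next
    case False
    then have "term_poly (Poly_Mapping.single j (Suc a) + u) \<in> I"
      using \<open>j \<in> {..n}\<close> by (intro borel_replace[OF borel inf t[unfolded tu'] u]) simp_all
    then have "term_poly (Poly_Mapping.single 0 a + (Poly_Mapping.single j (Suc a) + u)) \<in> I"
      by (rule ideal_term_plus[OF is_ideal_I]) (simp add: single_in_terms)
    then show ?thesis unfolding tu by (metis add.left_commute)
  qed
qed (use deg in auto)

text \<open>If a term \<open>x_0^a x_1^(t-a)\<close> were in \<open>I\<close>, exchanging
  \<open>x_0\<close> for \<open>x_1\<close> would put \<open>x_1^t\<close> in \<open>I\<close>.
  Without such a power all \<open>t + 1\<close> of these terms are standard, so the Hilbert function
  is unbounded.\<close>

lemma power_of_x1_mem:
  assumes n: "1 \<le> n"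
  shows "\<exists>N. term_poly (Poly_Mapping.single 1 N) \<in> I"
proof (rule ccontr)
  assume none: "\<nexists>N. term_poly (Poly_Mapping.single 1 N) \<in> I"
  have card: "t + 1 \<le> card (std_terms n I t)" for t
  proof -
    let ?g = "\<lambda>a. Poly_Mapping.single 0 a + Poly_Mapping.single 1 (t - a) :: term_exp"
    have "inj_on ?g {..t}"
    proof (rule inj_onI)
      fix a b assume "?g a = ?g b"
      then have "lookup (?g a) 0 = lookup (?g b) 0" by simp
      then show "a = b" by (simp add: lookup_add lookup_single)
    qed
    moreover have "?g a \<in> std_terms n I t" if a: "a \<le> t" for a
    proof -
      have "term_poly (?g a) \<notin> I"
      proof
        assume "term_poly (?g a) \<in> I"
        then have "term_poly (Poly_Mapping.single 1 a + Poly_Mapping.single 1 (t - a)) \<in> I"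
          by (rule borel_replace[OF borel inf _ _ _ n]) simp_all
        then have "term_poly (Poly_Mapping.single 1 (a + (t - a))) \<in> I"
          unfolding single_add .
        then show False using none by blast
      qed
      then show ?thesis
        using a n by (simp add: std_terms_def terms_of_deg_def terms_plus_iff single_in_terms term_deg_plus)
    qed
    ultimately have "card {..t} \<le> card (std_terms n I t)"
      by (intro card_inj_on_le[of ?g])
        (auto simp: std_terms_def intro: finite_subset[OF _ finite_terms_of_deg[of n t]])
    then show ?thesis by simp
  qed
  obtain t0 where t0: "\<And>t. t \<ge> t0 \<Longrightarrow> d = of_nat (card (std_terms n I t))"
    using hilb by (auto simp: is_hilbert_polynomial_def eventually_sequentially
        hilbert_function_eq_card[OF is_ideal_I monomial])
  obtain k where k: "d < of_nat k" using reals_Archimedean2 by blast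
  \<comment> \<open>From \<open>t0\<close> on the Hilbert function equals \<open>d\<close>, and
    \<open>d < k\<close>; this \<open>t\<close> therefore gives
    \<open>t + 1 \<le> d < k \<le> t\<close>.\<close>
  define t where "t = max t0 k"
  have "of_nat (t + 1) \<le> d" using card[of t] t0[of t] by (simp add: t_def del: of_nat_add)
  then have "of_nat (t + 1) < (of_nat k :: rat)" using k by linarith
  then show False by (simp add: t_def del: of_nat_add)
qed

text \<open>Multiples by \<open>x_0\<close> stay standard by \<open>ideal_colon_x0\<close>.
  Conversely, a term of degree \<open>m + 1\<close> without \<open>x_0\<close> lies in
  \<open>I\<close> by the socle argument for \<open>{1..n}\<close>: a power of \<open>x_1\<close> is
  in \<open>I\<close>, and Borel exchange gives the same power of the other variables.\<close>

lemma std_terms_Suc: "std_terms n I (Suc m) = (+) (var_exp 0) ` std_terms n I m"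
proof (intro equalityI subsetI)
  fix s assume "s \<in> (+) (var_exp 0) ` std_terms n I m"
  then show "s \<in> std_terms n I (Suc m)"
    using ideal_colon_x0
    by (auto simp: std_terms_def terms_of_deg_def terms_plus_iff term_deg_plus)
next
  fix s assume s: "s \<in> std_terms n I (Suc m)"
  then have sn: "s \<in> terms n" "term_deg s = Suc m" "term_poly s \<notin> I"
    by (auto simp: std_terms_def terms_of_deg_def)
  have "0 \<in> keys s"
  proof (rule ccontr)
    assume "0 \<notin> keys s"
    have keys: "keys s \<subseteq> {1..n}"
    proof
      fix i assume "i \<in> keys s"
      moreover have "i \<noteq> 0"
        using \<open>0 \<notin> keys s\<close> \<open>i \<in> keys s\<close> by metis
      moreover have "keys s \<subseteq> {..n}" using sn(1) by (simp add: terms_def)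
      ultimately have "1 \<le> i" "i \<le> n" by auto
      then show "i \<in> {1..n}" by simp
    qed
    \<comment> \<open>The degree \<open>m + 1\<close> is positive, so some variable occurs in
      \<open>s\<close>; as it is not \<open>x_0\<close>, this excludes \<open>n = 0\<close>.\<close>
    obtain i where "i \<in> keys s" using sn(2) by fastforce
    with keys have n: "1 \<le> n" by force
    obtain N where N: "term_poly (Poly_Mapping.single 1 N) \<in> I"
      using power_of_x1_mem[OF n] by blast
    have "term_poly s \<in> I"
    proof (rule saturated_in_high_degree[of "{1..n}"])
      fix j assume j: "j \<in> {1..n}"
      have "term_poly (Poly_Mapping.single j N) \<in> I"
      proof (cases "j = 1")
        case False
        then show ?thesis
          using borel_replace[OF borel inf, of 1 N 0 j] N j by simp
      qed (use N in simp)
      then have "term_poly (s + Poly_Mapping.single j N) \<in> I"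
        using ideal_term_plus[OF is_ideal_I] sn(1) by blast
      then show "\<exists>N. term_poly (Poly_Mapping.single j N + s) \<in> I"
        by (metis add.commute)
    qed (use n sn keys in auto)
    then show False using sn(3) by simp
  qed
  then have eq: "s = var_exp 0 + (s - var_exp 0)" by (simp add: var_plus_minus)
  have "s - var_exp 0 \<in> std_terms n I m"
    using sn ideal_term_plus[OF is_ideal_I, of "s - var_exp 0" "var_exp 0"]
      terms_plus_iff[of "var_exp 0" "s - var_exp 0" n] term_deg_plus[of "var_exp 0" "s - var_exp 0"]
    by (auto simp: std_terms_def terms_of_deg_def simp flip: eq)
  then show "s \<in> (+) (var_exp 0) ` std_terms n I m" using eq by blast
qed

end

theorem proposition5p11:
  fixes n m :: nat
    and I J :: "'k::field mpoly set"
    and p :: "rat poly"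
    and d :: rat
    and ord :: "(term_exp \<times> term_exp) set"
  assumes "infinite (UNIV :: 'k set)"
    and "borel_fixed_ideal n J" and "borel_fixed_ideal n I"
    and "m_regular n m J" and "m_regular n m I"
    and "is_hilbert_polynomial n J p" and "is_hilbert_polynomial n I p"
    and "p = [:d:]"
    and "term_order n ord"
  shows "span_dominated n m ord (ideal_piece n J m) (ideal_piece n I m) \<longleftrightarrow>
    span_dominated n (m + 1) ord (ideal_piece n J (m + 1)) (ideal_piece n I (m + 1))"
proof -
  have lin: "linear_order_on (terms n) ord"
    using assms(9) by (simp add: term_order_def)
  have sub: "std_terms n K t \<subseteq> terms_of_deg n t" for K :: "'k mpoly set" and t
    by (auto simp: std_terms_def)
  have terms: "std_terms n K t \<subseteq> terms n" for K :: "'k mpoly set" and t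
    by (auto simp: std_terms_def terms_of_deg_def)
  have dual: "span_dominated n t ord (ideal_piece n J t) (ideal_piece n I t) \<longleftrightarrow>
      dominated ord (std_terms n I t) (std_terms n J t)" for t
  proof -
    have "ideal_piece n K t = mpoly.span (term_poly ` (terms_of_deg n t - std_terms n K t))"
      if "borel_fixed_ideal n K" for K :: "'k mpoly set"
      using borel_ideal[OF that] borel_monomial[OF that assms(1)] by (rule ideal_piece_span)
    then have "span_dominated n t ord (ideal_piece n J t) (ideal_piece n I t) \<longleftrightarrow>
        dominated ord (terms_of_deg n t - std_terms n J t) (terms_of_deg n t - std_terms n I t)"
      using assms(2,3) by (simp add: span_dominated_iff)
    also have "\<dots> \<longleftrightarrow> dominated ord (std_terms n I t) (std_terms n J t)"
      by (rule dominated_Diff[symmetric, OF lin finite_terms_of_deg[of n t] _ sub sub])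
        (auto simp: terms_of_deg_def)
    finally show ?thesis .
  qed
  \<comment> \<open>For both ideals the standard terms of degree \<open>m + 1\<close> arise by the
    same multiplication by \<open>x_0\<close>, which preserves and reflects domination for every
    term order.\<close>
  have "dominated ord (std_terms n I (m + 1)) (std_terms n J (m + 1)) \<longleftrightarrow>
      dominated ord ((+) (var_exp 0) ` std_terms n I m) ((+) (var_exp 0) ` std_terms n J m)"
    using assms std_terms_Suc[of n I m d] std_terms_Suc[of n J m d] by simp
  also have "\<dots> \<longleftrightarrow> dominated ord (std_terms n I m) (std_terms n J m)"
    by (rule dominated_plus[OF assms(9) terms terms]) simp
  finally show ?thesis by (simp add: dual)
qed

end
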